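(* Let $\lambda$ denote the unique real root of $x^5-2x^4-2x^2-2x-1$ (approximately $2.48187$). Then for every real number $\gamma>\lambda$ there exists a permutation class $\mathcal{C}$ whose growth rate $\lim_{n\to\infty}\sqrt[n]{|\mathcal{C}_n|}$ exists and equals $\gamma$.
   Context: A permutation $\pi$ of length $n$ contains a permutation $\sigma$ of length $k$ if $\pi$ has a subsequence of length $k$ in the same relative order as $\sigma$. A permutation class is a set of permutations closed downward under containment. For a permutation class $\mathcal{C}$, $\mathcal{C}_n$ denotes the set of permutations in $\mathcal{C}$ of length $n$, and the growth rate of $\mathcal{C}$ is $\lim_{n\to\infty}\sqrt[n]{|\mathcal{C}_n|}$ when this limit exists. *)

theory Defs
  imports Complex_Main "HOL-Library.Sublist" "HOL-Combinatorics.Multiset_Permutations"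
begin

text \<open>
  Permutations of length \<open>n\<close> are in one-line notation: lists in which each of \<open>1, ..., n\<close>
  occurs exactly once. The empty permutation is the only one of length \<open>0\<close>.
\<close>

definition is_permutation :: "nat list \<Rightarrow> bool" where
  "is_permutation \<pi> \<longleftrightarrow> \<pi> \<in> permutations_of_set {1..length \<pi>}"

definition same_relative_order :: "nat list \<Rightarrow> nat list \<Rightarrow> bool" where
  "same_relative_order xs ys \<longleftrightarrow>
     length xs = length ys \<and>
     (\<forall>i<length xs. \<forall>j<length xs. xs ! i < xs ! j \<longleftrightarrow> ys ! i < ys ! j)"

text \<open>\<open>subseq\<close> is the library's not necessarily contiguous subsequence relation.\<close>

definition contains :: "nat list \<Rightarrow> nat list \<Rightarrow> bool" where
  "contains \<pi> \<sigma> \<longleftrightarrow> (\<exists>xs. subseq xs \<pi> \<and> same_relative_order xs \<sigma>)"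

definition permutation_class :: "nat list set \<Rightarrow> bool" where
  "permutation_class C \<longleftrightarrow>
     (\<forall>\<pi>\<in>C. is_permutation \<pi>) \<and>
     (\<forall>\<pi>\<in>C. \<forall>\<sigma>. is_permutation \<sigma> \<longrightarrow> contains \<pi> \<sigma> \<longrightarrow> \<sigma> \<in> C)"

definition of_length :: "nat list set \<Rightarrow> nat \<Rightarrow> nat list set" where
  "of_length C n = {\<pi> \<in> C. length \<pi> = n}"

definition has_growth_rate :: "nat list set \<Rightarrow> real \<Rightarrow> bool" where
  "has_growth_rate C \<gamma> \<longleftrightarrow> (\<lambda>n. root n (real (card (of_length C n)))) \<longlonglongrightarrow> \<gamma>"

definition quintic :: "real \<Rightarrow> real" where
  "quintic x = x ^ 5 - 2 * x ^ 4 - 2 * x ^ 2 - 2 * x - 1"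

text \<open>Approximately 2.48187; \<open>THE\<close> is meaningful only together with uniqueness of the root.\<close>

definition lam :: real where
  "lam = (THE x. quintic x = 0)"

end

theory Submission
  imports Defs "HOL-Library.Product_Lexorder"
begin

text \<open>
  A class closed under direct sums is determined by its sum indecomposable members; if it has \<open>s\<^sub>n\<close> of
  length \<open>n\<close>, with \<open>s\<^sub>n\<close> bounded and \<open>\<Sum>s\<^sub>n \<gamma>\<^sup>-\<^sup>n = 1\<close>, then the renewal equation shows that its counting
  sequence lies between two constant multiples of \<open>\<gamma>\<^sup>n\<close>. So it suffices to find a downset of
  indecomposables solving this equation.

  Inflate the two ends of an increasing oscillation by increasing sequences of lengths \<open>a\<close> and \<open>b\<close>.
  For \<open>a, b \<ge> 2\<close> and \<open>a + b = s\<close> fixed, every proper indecomposable pattern of such a permutation is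
  again an inflated oscillation, with \<open>a + b < s\<close>. Hence any set of these permutations, the fillers, can be added
  freely to the base consisting of the inflated oscillations with \<open>a + b < s\<close>, to which one also
  adds all indecomposables of length less than \<open>k\<close> and some of length \<open>k\<close>, where \<open>k\<close> is as large as
  \<open>\<Sum>s\<^sub>n \<gamma>\<^sup>-\<^sup>n \<le> 1\<close> permits. There are \<open>2 (s - 3)\<close> fillers of each large length, so for
  \<open>\<gamma> \<le> 2 (s - 3) + 1\<close> a greedy choice of fillers closes the remaining gap. For \<open>s = 4\<close> the base together
  with all indecomposables of length at most 3 is dominated by the sequence \<open>1, 1, 3, 5, 6, 6, \<dots>\<close>,
  whose equation \<open>\<Sum>s\<^sub>n x\<^sup>-\<^sup>n = 1\<close> is \<open>x\<^sup>5 - 2x\<^sup>4 - 2x\<^sup>2 - 2x - 1 = 0\<close>.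
\<close>

section \<open>Containment\<close>

lemma subseq_imp_index_map:
  assumes "subseq xs ys"
  shows "\<exists>f. strict_mono_on {..<length xs} f \<and> (\<forall>i<length xs. f i < length ys \<and> xs ! i = ys ! f i)"
proof -
  obtain N where N: "xs = nths ys N" using assms by (auto simp: subseq_conv_nths)
  define ks where "ks = filter (\<lambda>i. i \<in> N) [0..<length ys]"
  have xs: "xs = map ((!) ys) ks"
    unfolding N ks_def nths_def
    by (subst map_nth[of ys, symmetric], subst zip_map1) 
       (simp add: filter_map o_def zip_same_conv_map)
  have "sorted_wrt (<) ks" unfolding ks_def
    by (intro sorted_wrt_filter) simp
  then have "strict_mono_on {..<length xs} ((!) ks)"
    by (auto simp: strict_mono_on_def xs sorted_wrt_iff_nth_less)
  moreover have "\<forall>i<length xs. ks ! i < length ys \<and> xs ! i = ys ! (ks ! i)"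
  proof (intro allI impI conjI)
    fix i assume "i < length xs"
    then have "ks ! i \<in> set ks" by (simp add: xs)
    then show "ks ! i < length ys" by (auto simp: ks_def)
    show "xs ! i = ys ! (ks ! i)" using \<open>i < length xs\<close> by (simp add: xs)
  qed
  ultimately show ?thesis by blast
qed

lemma index_map_imp_subseq:
  assumes "strict_mono_on {..<n} f" "\<And>i. i < n \<Longrightarrow> f i < length ys"
  shows "subseq (map (\<lambda>i. ys ! f i) [0..<n]) ys"
proof -
  have srt: "sorted_wrt (<) (map f [0..<n])"
    using assms(1) by (auto simp: sorted_wrt_iff_nth_less strict_mono_on_def)
  have "map f [0..<n] = filter (\<lambda>j. j \<in> f ` {..<n}) [0..<length ys]"
  proof (rule sorted_distinct_set_unique)
    show "sorted (map f [0..<n])" "distinct (map f [0..<n])"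
      using srt by (auto simp: strict_sorted_iff)
    show "set (map f [0..<n]) = set (filter (\<lambda>j. j \<in> f ` {..<n}) [0..<length ys])"
      using assms(2) by auto
  qed (auto intro: sorted_wrt_filter)
  then have "subseq (map f [0..<n]) [0..<length ys]" by simp
  then have "subseq (map ((!) ys) (map f [0..<n])) (map ((!) ys) [0..<length ys])"
    by (rule subseq_map)
  then show ?thesis by (simp add: o_def map_nth)
qed

text \<open>Index maps replace subsequences from here on: they compose, which gives transitivity,
  and they can be restricted to blocks of positions.\<close>

lemma contains_iff:
  "contains \<pi> \<sigma> \<longleftrightarrow> (\<exists>f. strict_mono_on {..<length \<sigma>} f \<and> (\<forall>i<length \<sigma>. f i < length \<pi>) \<and>
     (\<forall>i<length \<sigma>. \<forall>j<length \<sigma>. \<pi> ! f i < \<pi> ! f j \<longleftrightarrow> \<sigma> ! i < \<sigma> ! j))"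
proof
  assume "contains \<pi> \<sigma>"
  then obtain xs where xs: "subseq xs \<pi>" "same_relative_order xs \<sigma>" by (auto simp: contains_def)
  from subseq_imp_index_map[OF xs(1)] xs(2)
  show "\<exists>f. strict_mono_on {..<length \<sigma>} f \<and> (\<forall>i<length \<sigma>. f i < length \<pi>) \<and>
     (\<forall>i<length \<sigma>. \<forall>j<length \<sigma>. \<pi> ! f i < \<pi> ! f j \<longleftrightarrow> \<sigma> ! i < \<sigma> ! j)"
    unfolding same_relative_order_def by metis
next
  assume "\<exists>f. strict_mono_on {..<length \<sigma>} f \<and> (\<forall>i<length \<sigma>. f i < length \<pi>) \<and>
     (\<forall>i<length \<sigma>. \<forall>j<length \<sigma>. \<pi> ! f i < \<pi> ! f j \<longleftrightarrow> \<sigma> ! i < \<sigma> ! j)"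
  then obtain f where f: "strict_mono_on {..<length \<sigma>} f" "\<forall>i<length \<sigma>. f i < length \<pi>"
     "\<forall>i<length \<sigma>. \<forall>j<length \<sigma>. \<pi> ! f i < \<pi> ! f j \<longleftrightarrow> \<sigma> ! i < \<sigma> ! j" by blast
  show "contains \<pi> \<sigma>" unfolding contains_def
  proof (intro exI conjI)
    show "subseq (map (\<lambda>i. \<pi> ! f i) [0..<length \<sigma>]) \<pi>"
      using f by (intro index_map_imp_subseq) auto
    show "same_relative_order (map (\<lambda>i. \<pi> ! f i) [0..<length \<sigma>]) \<sigma>"
      using f(3) by (simp add: same_relative_order_def)
  qed
qed

lemma contains_trans:
  assumes "contains \<pi> \<sigma>" "contains \<sigma> \<tau>"
  shows "contains \<pi> \<tau>"
proof -
  obtain f where f: "strict_mono_on {..<length \<sigma>} f" "\<forall>i<length \<sigma>. f i < length \<pi>"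
     "\<forall>i<length \<sigma>. \<forall>j<length \<sigma>. \<pi> ! f i < \<pi> ! f j \<longleftrightarrow> \<sigma> ! i < \<sigma> ! j"
    using assms(1) by (auto simp: contains_iff)
  obtain g where g: "strict_mono_on {..<length \<tau>} g" "\<forall>i<length \<tau>. g i < length \<sigma>"
     "\<forall>i<length \<tau>. \<forall>j<length \<tau>. \<sigma> ! g i < \<sigma> ! g j \<longleftrightarrow> \<tau> ! i < \<tau> ! j"
    using assms(2) by (auto simp: contains_iff)
  show ?thesis unfolding contains_iff
  proof (intro exI[of _ "f \<circ> g"] conjI)
    show "strict_mono_on {..<length \<tau>} (f \<circ> g)"
      using f g by (auto simp: strict_mono_on_def)
  qed (use f g in auto)
qed

lemma contains_length_le: "contains \<pi> \<sigma> \<Longrightarrow> length \<sigma> \<le> length \<pi>"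
  unfolding contains_def same_relative_order_def using list_emb_length by fastforce

lemma is_permutation_iff: "is_permutation \<pi> \<longleftrightarrow> distinct \<pi> \<and> set \<pi> = {1..length \<pi>}"
  by (auto simp: is_permutation_def permutations_of_set_def)

lemma is_permutationI:
  assumes "distinct \<pi>" "set \<pi> \<subseteq> {1..length \<pi>}"
  shows "is_permutation \<pi>"
  unfolding is_permutation_iff
proof
  show "set \<pi> = {1..length \<pi>}"
    by (rule card_subset_eq) (use assms in \<open>auto simp: distinct_card\<close>)
qed fact

lemma finite_permutations: "finite {\<pi>. is_permutation \<pi> \<and> length \<pi> = n}"
  by (rule finite_subset[of _ "permutations_of_set {1..n}"]) (auto simp: is_permutation_def)

lemma card_permutations: "card {\<pi>. is_permutation \<pi> \<and> length \<pi> = n} = fact n"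
proof -
  have "{\<pi>. is_permutation \<pi> \<and> length \<pi> = n} = permutations_of_set {1..n}"
  proof (intro set_eqI iffI)
    fix \<pi> assume "\<pi> \<in> permutations_of_set {1..n}"
    moreover from this have "length \<pi> = n" using length_finite_permutations_of_set by fastforce
    ultimately show "\<pi> \<in> {\<pi>. is_permutation \<pi> \<and> length \<pi> = n}" by (simp add: is_permutation_def)
  qed (auto simp: is_permutation_def)
  then show ?thesis by simp
qed

section \<open>Permutations of point configurations\<close>

definition rank :: "('p \<Rightarrow> 'k::linorder) \<Rightarrow> 'p set \<Rightarrow> 'p \<Rightarrow> nat" where
  "rank X P p = card {q \<in> P. X q < X p}"

text \<open>Reads the heights of the points from left to right: \<open>inv_into\<close> finds the
  point at horizontal position \<open>i\<close>. Meaningful when \<open>P\<close> is finite and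
  \<open>X\<close> is injective on it. Only comparisons of keys enter, so points can carry labels of
  any convenient ordered type.\<close>

definition perm_of :: "('p \<Rightarrow> 'k::linorder) \<Rightarrow> ('p \<Rightarrow> 'l::linorder) \<Rightarrow> 'p set \<Rightarrow> nat list" where
  "perm_of X Y P = map (\<lambda>i. Suc (rank Y P (inv_into P (rank X P) i))) [0..<card P]"

lemma rank_less_iff:
  assumes "finite P" "p \<in> P" "q \<in> P"
  shows "rank X P p < rank X P q \<longleftrightarrow> X p < X q"
proof -
  have *: "rank X P p < rank X P q" if "X p < X q" "p \<in> P" "q \<in> P" for p q
    unfolding rank_def using that assms(1) by (intro psubset_card_mono) auto
  have "rank X P q \<le> rank X P p" if "X q \<le> X p"
    unfolding rank_def using that assms(1) by (intro card_mono) auto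
  then show ?thesis using * assms by (meson leD leI)
qed

lemma bij_betw_rank:
  assumes "finite P" "inj_on X P"
  shows "bij_betw (rank X P) P {..<card P}"
proof -
  have inj: "inj_on (rank X P) P"
  proof (rule inj_onI)
    fix p q assume pq: "p \<in> P" "q \<in> P" "rank X P p = rank X P q"
    then have "X p = X q"
      using rank_less_iff[OF assms(1), of p q X] rank_less_iff[OF assms(1), of q p X] by force
    then show "p = q" using assms(2) pq by (simp add: inj_on_eq_iff)
  qed
  moreover have "rank X P ` P \<subseteq> {..<card P}"
    unfolding rank_def using assms(1) by (auto intro!: psubset_card_mono)
  ultimately show ?thesis
    unfolding bij_betw_def by (simp add: card_subset_eq card_image)
qed

lemma length_perm_of [simp]: "length (perm_of X Y P) = card P"
  by (simp add: perm_of_def)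

lemma rank_less_card: "finite P \<Longrightarrow> p \<in> P \<Longrightarrow> rank X P p < card P"
  unfolding rank_def by (auto intro!: psubset_card_mono)

lemma nth_perm_of:
  assumes "finite P" "inj_on X P" "p \<in> P"
  shows "perm_of X Y P ! rank X P p = Suc (rank Y P p)"
proof -
  have "inv_into P (rank X P) (rank X P p) = p"
    using bij_betw_rank[OF assms(1,2)] assms(3) by (simp add: bij_betw_def)
  then show ?thesis using rank_less_card[OF assms(1,3), of X] by (simp add: perm_of_def)
qed

lemma rank_surj:
  assumes "finite P" "inj_on X P" "i < card P"
  obtains p where "p \<in> P" "i = rank X P p"
  using bij_betw_rank[OF assms(1,2)] assms(3) by (metis bij_betw_iff_bijections lessThan_iff)

lemma perm_of_unique:
  assumes "finite P" "inj_on X P" "length \<pi> = card P"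
    "\<And>p. p \<in> P \<Longrightarrow> \<pi> ! rank X P p = Suc (rank Y P p)"
  shows "\<pi> = perm_of X Y P"
proof (rule nth_equalityI)
  fix i assume "i < length \<pi>"
  then obtain p where "p \<in> P" "i = rank X P p"
    using rank_surj[OF assms(1,2)] assms(3) by metis
  then show "\<pi> ! i = perm_of X Y P ! i" using assms by (simp add: nth_perm_of)
qed (simp add: assms(3))

lemma is_permutation_perm_of:
  assumes "finite P" "inj_on X P" "inj_on Y P"
  shows "is_permutation (perm_of X Y P)"
proof (rule is_permutationI)
  show "distinct (perm_of X Y P)"
    unfolding distinct_conv_nth
  proof (intro allI impI)
    fix i j assume ij: "i < length (perm_of X Y P)" "j < length (perm_of X Y P)" "i \<noteq> j"
    obtain p q where pq: "p \<in> P" "i = rank X P p" "q \<in> P" "j = rank X P q"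
      using ij rank_surj[OF assms(1,2)] by (metis length_perm_of)
    then have "rank Y P p \<noteq> rank Y P q"
      using ij(3) bij_betw_rank[OF assms(1,3)] by (auto simp: bij_betw_def inj_on_def)
    then show "perm_of X Y P ! i \<noteq> perm_of X Y P ! j"
      using pq by (simp add: nth_perm_of assms)
  qed
  show "set (perm_of X Y P) \<subseteq> {1..length (perm_of X Y P)}"
  proof
    fix v assume "v \<in> set (perm_of X Y P)"
    then obtain i where i: "i < card P" "v = perm_of X Y P ! i" by (auto simp: in_set_conv_nth)
    then obtain p where "p \<in> P" "i = rank X P p" using rank_surj[OF assms(1,2)] by metis
    then show "v \<in> {1..length (perm_of X Y P)}"
      using i rank_less_card[of P p Y] assms by (auto simp: nth_perm_of)
  qed
qed

text \<open>The values below \<open>\<pi> ! i\<close> are \<open>1, ..., \<pi> ! i - 1\<close>, each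
  taken once; hence the order relations alone recover the entries.\<close>

lemma nth_permutation:
  assumes "is_permutation \<pi>" "i < length \<pi>"
  shows "\<pi> ! i = Suc (card {j. j < length \<pi> \<and> \<pi> ! j < \<pi> ! i})"
proof -
  have d: "distinct \<pi>" "set \<pi> = {1..length \<pi>}" using assms(1) by (auto simp: is_permutation_iff)
  have mem: "\<pi> ! i \<in> {1..length \<pi>}" using assms(2) d(2) nth_mem by blast
  have "(!) \<pi> ` {j. j < length \<pi> \<and> \<pi> ! j < \<pi> ! i} = {v \<in> set \<pi>. v < \<pi> ! i}"
    by (auto simp: in_set_conv_nth)
  also have "\<dots> = {1..<\<pi> ! i}" using mem by (auto simp: d(2))
  finally have "card ((!) \<pi> ` {j. j < length \<pi> \<and> \<pi> ! j < \<pi> ! i}) = \<pi> ! i - 1" by simp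
  moreover have "inj_on ((!) \<pi>) {j. j < length \<pi> \<and> \<pi> ! j < \<pi> ! i}"
    using d(1) by (auto simp: inj_on_def nth_eq_iff_index_eq)
  ultimately show ?thesis using mem by (simp add: card_image)
qed

lemma perm_of_self:
  assumes "is_permutation \<pi>"
  shows "\<pi> = perm_of (\<lambda>i. i) ((!) \<pi>) {..<length \<pi>}"
proof (rule perm_of_unique)
  fix p assume p: "p \<in> {..<length \<pi>}"
  have "rank (\<lambda>i. i) {..<length \<pi>} p = p"
  proof -
    have "{q \<in> {..<length \<pi>}. q < p} = {..<p}" using p by auto
    then show ?thesis by (simp add: rank_def)
  qed
  then show "\<pi> ! rank (\<lambda>i. i) {..<length \<pi>} p = Suc (rank ((!) \<pi>) {..<length \<pi>} p)"
    using nth_permutation[OF assms, of p] p by (simp add: rank_def)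
qed auto

lemma rank_image:
  assumes "bij_betw g P Q" "\<And>p q. p \<in> P \<Longrightarrow> q \<in> P \<Longrightarrow> X' (g p) < X' (g q) \<longleftrightarrow> X p < X q" "p \<in> P"
  shows "rank X' Q (g p) = rank X P p"
proof -
  have eq: "g ` {q \<in> P. X q < X p} = {q \<in> Q. X' q < X' (g p)}"
  proof (intro equalityI subsetI)
    fix u assume "u \<in> {q \<in> Q. X' q < X' (g p)}"
    then have u: "u \<in> Q" "X' u < X' (g p)" by auto
    then obtain q where "q \<in> P" "u = g q" using bij_betw_imp_surj_on[OF assms(1)] by auto
    then show "u \<in> g ` {q \<in> P. X q < X p}" using assms(2)[of q p] assms(3) u(2) by auto
  next
    fix u assume "u \<in> g ` {q \<in> P. X q < X p}"
    then obtain q where "q \<in> P" "u = g q" "X q < X p" by auto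
    then show "u \<in> {q \<in> Q. X' q < X' (g p)}"
      using assms(2)[of q p] assms(3) bij_betwE[OF assms(1)] by auto
  qed
  have inj: "inj_on g {q \<in> P. X q < X p}"
    using bij_betw_imp_inj_on[OF assms(1)] by (rule inj_on_subset) auto
  show ?thesis using card_image[OF inj] unfolding eq by (simp add: rank_def)
qed

text \<open>An order isomorphism in both coordinates preserves all ranks, so the permutation depends
  only on the order type of the configuration.\<close>

lemma perm_of_cong_bij:
  assumes g: "bij_betw g P Q" and fin: "finite P" and inj: "inj_on X P"
    and X: "\<And>p q. p \<in> P \<Longrightarrow> q \<in> P \<Longrightarrow> X' (g p) < X' (g q) \<longleftrightarrow> X p < X q"
    and Y: "\<And>p q. p \<in> P \<Longrightarrow> q \<in> P \<Longrightarrow> Y' (g p) < Y' (g q) \<longleftrightarrow> Y p < Y q"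
  shows "perm_of X' Y' Q = perm_of X Y P"
proof (rule perm_of_unique[OF fin inj])
  have finQ: "finite Q" using g fin bij_betw_finite by blast
  have injQ: "inj_on X' Q"
  proof (rule inj_onI)
    fix u v assume "u \<in> Q" "v \<in> Q" "X' u = X' v"
    moreover then obtain p q where "p \<in> P" "q \<in> P" "u = g p" "v = g q"
      using g by (auto simp: bij_betw_def)
    ultimately have "\<not> X p < X q" "\<not> X q < X p" using X by (metis less_irrefl)+
    then have "X p = X q" by simp
    then show "u = v" using \<open>p \<in> P\<close> \<open>q \<in> P\<close> \<open>u = g p\<close> \<open>v = g q\<close> inj by (simp add: inj_on_eq_iff)
  qed
  show "length (perm_of X' Y' Q) = card P" using g by (simp add: bij_betw_same_card)
  fix p assume p: "p \<in> P"
  have "perm_of X' Y' Q ! rank X' Q (g p) = Suc (rank Y' Q (g p))"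
    using p g by (intro nth_perm_of[OF finQ injQ]) (auto simp: bij_betw_def)
  then show "perm_of X' Y' Q ! rank X P p = Suc (rank Y P p)"
    using rank_image[of g P Q X' X p] rank_image[of g P Q Y' Y p] X Y g p by simp
qed

text \<open>Matching points of equal horizontal rank preserves \<open>X\<close> by construction;
  equality of the permutations forces the vertical ranks to agree too.\<close>

lemma perm_of_eq_imp_bij:
  assumes fin: "finite P" "finite Q" and inj: "inj_on X P" "inj_on X' Q"
    and eq: "perm_of X Y P = perm_of X' Y' Q"
  obtains g where "bij_betw g P Q"
    "\<And>p q. p \<in> P \<Longrightarrow> q \<in> P \<Longrightarrow> X' (g p) < X' (g q) \<longleftrightarrow> X p < X q"
    "\<And>p q. p \<in> P \<Longrightarrow> q \<in> P \<Longrightarrow> Y' (g p) < Y' (g q) \<longleftrightarrow> Y p < Y q"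
proof -
  have card: "card P = card Q" using arg_cong[OF eq, of length] by simp
  define g where "g = inv_into Q (rank X' Q) \<circ> rank X P"
  have bP: "bij_betw (rank X P) P {..<card P}" and bQ: "bij_betw (rank X' Q) Q {..<card P}"
    using bij_betw_rank[OF fin(1) inj(1)] bij_betw_rank[OF fin(2) inj(2)] card by simp_all
  have g: "bij_betw g P Q" unfolding g_def
    by (rule bij_betw_trans[OF bP bij_betw_inv_into[OF bQ]])
  have rX: "rank X' Q (g p) = rank X P p" if "p \<in> P" for p
  proof -
    have "rank X P p \<in> rank X' Q ` Q"
      using that bij_betw_imp_surj_on[OF bQ] bij_betwE[OF bP] by auto
    then show ?thesis by (simp add: g_def f_inv_into_f)
  qed
  have gQ: "g p \<in> Q" if "p \<in> P" for p using g that by (auto simp: bij_betw_def)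
  have rY: "rank Y' Q (g p) = rank Y P p" if p: "p \<in> P" for p
    using nth_perm_of[OF fin(1) inj(1) p, of Y] nth_perm_of[OF fin(2) inj(2) gQ[OF p], of Y'] rX[OF p]
    by (simp add: eq)
  show thesis
    by (rule that[OF g]; metis rank_less_iff fin gQ rX rY)
qed

text \<open>Pulling the index map of an occurrence back through \<open>rank X P\<close> turns
  patterns of a configuration into subsets of its points.\<close>

lemma contains_perm_of:
  assumes fin: "finite P" and inj: "inj_on X P" and \<tau>: "is_permutation \<tau>"
    and c: "contains (perm_of X Y P) \<tau>"
  obtains Q where "Q \<subseteq> P" "\<tau> = perm_of X Y Q"
proof -
  obtain f where f: "strict_mono_on {..<length \<tau>} f" "\<forall>i<length \<tau>. f i < card P"
     "\<forall>i<length \<tau>. \<forall>j<length \<tau>. perm_of X Y P ! f i < perm_of X Y P ! f j \<longleftrightarrow> \<tau> ! i < \<tau> ! j"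
    using c by (auto simp: contains_iff)
  define h where "h = inv_into P (rank X P) \<circ> f"
  have b: "bij_betw (rank X P) P {..<card P}" by (rule bij_betw_rank[OF fin inj])
  have hP: "h i \<in> P" and rh: "rank X P (h i) = f i" if "i < length \<tau>" for i
    using b f(2) that by (auto simp: h_def bij_betw_def inv_into_into f_inv_into_f)
  have hX: "X (h i) < X (h j) \<longleftrightarrow> i < j" if "i < length \<tau>" "j < length \<tau>" for i j
  proof -
    have "X (h i) < X (h j) \<longleftrightarrow> f i < f j"
      using rank_less_iff[OF fin hP hP, of i j X] that by (simp add: rh)
    also have "\<dots> \<longleftrightarrow> i < j" using f(1) that by (simp add: strict_mono_on_less)
    finally show ?thesis .
  qed
  have hY: "Y (h i) < Y (h j) \<longleftrightarrow> \<tau> ! i < \<tau> ! j" if "i < length \<tau>" "j < length \<tau>" for i j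
  proof -
    have "Y (h i) < Y (h j) \<longleftrightarrow> perm_of X Y P ! f i < perm_of X Y P ! f j"
      using rank_less_iff[OF fin hP hP, of i j Y] that nth_perm_of[OF fin inj hP, of _ Y]
      by (simp flip: rh)
    then show ?thesis using f(3) that by simp
  qed
  have "inj_on h {..<length \<tau>}"
    by (rule inj_onI) (metis hX lessThan_iff less_irrefl linorder_neqE_nat)
  then have "bij_betw h {..<length \<tau>} (h ` {..<length \<tau>})" by (simp add: bij_betw_def)
  then have "perm_of X Y (h ` {..<length \<tau>}) = perm_of (\<lambda>i. i) ((!) \<tau>) {..<length \<tau>}"
    by (rule perm_of_cong_bij) (auto simp: hX hY)
  then have "\<tau> = perm_of X Y (h ` {..<length \<tau>})" using perm_of_self[OF \<tau>] by simp
  then show thesis using hP by (intro that[of "h ` {..<length \<tau>}"]) auto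
qed

section \<open>Sum closed classes\<close>

text \<open>Sum indecomposability: no proper nonempty prefix lies entirely below what follows it.
  Since entries are distinct, the final comparison is automatically strict.\<close>

definition indecomposable :: "nat list \<Rightarrow> bool" where
  "indecomposable \<tau> \<longleftrightarrow> is_permutation \<tau> \<and> \<tau> \<noteq> [] \<and>
     (\<forall>k. 0 < k \<and> k < length \<tau> \<longrightarrow> (\<exists>i<k. \<exists>j. k \<le> j \<and> j < length \<tau> \<and> \<tau> ! j \<le> \<tau> ! i))"

definition dsum :: "nat list \<Rightarrow> nat list \<Rightarrow> nat list" where
  "dsum \<alpha> \<beta> = \<alpha> @ map (\<lambda>v. v + length \<alpha>) \<beta>"

text \<open>Described by its indecomposable patterns rather than as the set of direct sums over
  \<open>I\<close>; closure under containment is then just transitivity, and the decomposition into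
  summands is derived for downward closed \<open>I\<close>.\<close>

definition sum_class :: "nat list set \<Rightarrow> nat list set" where
  "sum_class I = {\<pi>. is_permutation \<pi> \<and> (\<forall>\<tau>. indecomposable \<tau> \<and> contains \<pi> \<tau> \<longrightarrow> \<tau> \<in> I)}"

lemma permutation_class_sum_class: "permutation_class (sum_class I)"
  unfolding permutation_class_def sum_class_def using contains_trans by blast

lemma length_dsum [simp]: "length (dsum \<alpha> \<beta>) = length \<alpha> + length \<beta>"
  by (simp add: dsum_def)

lemma nth_dsum: "i < length \<alpha> + length \<beta> \<Longrightarrow>
    dsum \<alpha> \<beta> ! i = (if i < length \<alpha> then \<alpha> ! i else \<beta> ! (i - length \<alpha>) + length \<alpha>)"
  by (auto simp: dsum_def nth_append)

lemma nth_permutation_bounds: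
  assumes "is_permutation \<pi>" "i < length \<pi>"
  shows "1 \<le> \<pi> ! i" "\<pi> ! i \<le> length \<pi>"
proof -
  have "\<pi> ! i \<in> {1..length \<pi>}" using assms nth_mem by (fastforce simp: is_permutation_iff)
  then show "1 \<le> \<pi> ! i" "\<pi> ! i \<le> length \<pi>" by auto
qed

lemma is_permutation_dsum:
  assumes "is_permutation \<alpha>" "is_permutation \<beta>"
  shows "is_permutation (dsum \<alpha> \<beta>)"
proof -
  have a: "distinct \<alpha>" "set \<alpha> = {1..length \<alpha>}" and b: "distinct \<beta>" "set \<beta> = {1..length \<beta>}"
    using assms by (auto simp: is_permutation_iff)
  show ?thesis
  proof (rule is_permutationI)
    show "distinct (dsum \<alpha> \<beta>)"
      unfolding dsum_def using a b by (auto simp: distinct_map)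
    show "set (dsum \<alpha> \<beta>) \<subseteq> {1..length (dsum \<alpha> \<beta>)}"
      unfolding dsum_def set_append set_map a(2) b(2) by auto
  qed
qed

text \<open>Counting smaller entries bounds the first \<open>k\<close> values by \<open>k\<close>
  and puts the others above \<open>k\<close>, so both parts are permutations after subtracting
  \<open>k\<close> from the second.\<close>

lemma split_permutation:
  assumes p: "is_permutation \<pi>" and k: "k \<le> length \<pi>"
    and sep: "\<And>i j. i < k \<Longrightarrow> k \<le> j \<Longrightarrow> j < length \<pi> \<Longrightarrow> \<pi> ! i < \<pi> ! j"
  obtains \<alpha> \<beta> where "is_permutation \<alpha>" "is_permutation \<beta>" "length \<alpha> = k" "\<pi> = dsum \<alpha> \<beta>"
proof -
  have lo: "\<pi> ! i \<le> k" if i: "i < k" for i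
  proof -
    have "{j. j < length \<pi> \<and> \<pi> ! j < \<pi> ! i} \<subseteq> {..<k} - {i}"
      using sep[OF i] by (auto simp: not_less[symmetric] dest: order.strict_trans)
    then have "card {j. j < length \<pi> \<and> \<pi> ! j < \<pi> ! i} \<le> k - 1"
      using card_mono[of "{..<k} - {i}"] i by fastforce
    then show ?thesis using nth_permutation[OF p, of i] i k by simp
  qed
  have hi: "k < \<pi> ! j" if j: "k \<le> j" "j < length \<pi>" for j
  proof -
    have "{..<k} \<subseteq> {i. i < length \<pi> \<and> \<pi> ! i < \<pi> ! j}" using sep j by auto
    then have "k \<le> card {i. i < length \<pi> \<and> \<pi> ! i < \<pi> ! j}"
      using card_mono[of "{i. i < length \<pi> \<and> \<pi> ! i < \<pi> ! j}" "{..<k}"] by simp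
    then show ?thesis using nth_permutation[OF p j(2)] by simp
  qed
  have d: "distinct \<pi>" using p by (simp add: is_permutation_iff)
  have sd: "k < v \<and> v \<le> length \<pi>" if "v \<in> set (drop k \<pi>)" for v
    using that hi nth_permutation_bounds[OF p] by (auto simp: in_set_conv_nth)
  define \<beta> where "\<beta> = map (\<lambda>v. v - k) (drop k \<pi>)"
  show thesis
  proof (rule that)
    show "is_permutation (take k \<pi>)"
    proof (rule is_permutationI)
      show "set (take k \<pi>) \<subseteq> {1..length (take k \<pi>)}"
      proof
        fix v assume "v \<in> set (take k \<pi>)"
        then obtain i where "i < k" "i < length \<pi>" "v = \<pi> ! i" by (auto simp: in_set_conv_nth)
        then show "v \<in> {1..length (take k \<pi>)}"
          using lo[of i] nth_permutation_bounds[OF p, of i] k by simp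
      qed
    qed (use d in simp)
    show "is_permutation \<beta>"
    proof (rule is_permutationI)
      show "distinct \<beta>" unfolding \<beta>_def distinct_map
      proof
        show "inj_on (\<lambda>v. v - k) (set (drop k \<pi>))"
          by (rule inj_onI) (use sd in fastforce)
      qed (use d in simp)
      show "set \<beta> \<subseteq> {1..length \<beta>}" unfolding \<beta>_def using sd by fastforce
    qed
    show "length (take k \<pi>) = k" using k by simp
    have "map (\<lambda>v. v + k) \<beta> = drop k \<pi>"
      unfolding \<beta>_def map_map by (rule map_idI) (use sd in fastforce)
    then show "\<pi> = dsum (take k \<pi>) \<beta>" using k by (simp add: dsum_def)
  qed
qed

text \<open>Cut after the shortest nonempty prefix lying below everything that follows. The whole
  permutation is a candidate, and minimality makes the prefix indecomposable.\<close>

lemma ex_indecomposable_dsum: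
  assumes p: "is_permutation \<pi>" and ne: "\<pi> \<noteq> []"
  obtains \<alpha> \<beta> where "indecomposable \<alpha>" "is_permutation \<beta>" "\<pi> = dsum \<alpha> \<beta>"
proof -
  let ?S = "\<lambda>k. 0 < k \<and> k \<le> length \<pi> \<and> (\<forall>i<k. \<forall>j. k \<le> j \<and> j < length \<pi> \<longrightarrow> \<pi> ! i < \<pi> ! j)"
  define k where "k = (LEAST k. ?S k)"
  have "?S (length \<pi>)" using ne by auto
  then have k: "?S k" unfolding k_def by (rule LeastI)
  have least: "\<not> ?S k'" if "k' < k" for k' using that not_less_Least unfolding k_def by blast
  obtain \<alpha> \<beta> where ab: "is_permutation \<alpha>" "is_permutation \<beta>" "length \<alpha> = k" "\<pi> = dsum \<alpha> \<beta>"
    using split_permutation[OF p, of k] k by metis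
  have "indecomposable \<alpha>" unfolding indecomposable_def
  proof (intro conjI allI impI)
    show "is_permutation \<alpha>" "\<alpha> \<noteq> []" using ab k by auto
    fix k' assume k': "0 < k' \<and> k' < length \<alpha>"
    then have "\<not> ?S k'" using least[of k'] ab(3) by blast
    moreover have "0 < k'" "k' \<le> length \<pi>" using k' ab k by auto
    ultimately obtain i j where ij: "i < k'" "k' \<le> j" "j < length \<pi>" "\<pi> ! j \<le> \<pi> ! i"
      by (meson not_less)
    \<comment> \<open>The inversion across \<open>k'\<close> stays inside the prefix, because
      entries from position \<open>k\<close> on exceed all entries before it.\<close>
    have "j < k" using ij k k' ab(3) by (meson leD le_less_linear less_trans)
    then show "\<exists>i<k'. \<exists>j. k' \<le> j \<and> j < length \<alpha> \<and> \<alpha> ! j \<le> \<alpha> ! i"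
      using ij ab k' by (intro exI[of _ i] conjI exI[of _ j]) (auto simp: nth_dsum)
  qed
  then show thesis using that ab by blast
qed

text \<open>If \<open>\<alpha>'\<close> were longer, the position \<open>length \<alpha>\<close>
  would cut it properly; but in \<open>dsum \<alpha> \<beta>\<close> no inversion crosses that
  cut.\<close>

lemma dsum_inject_aux:
  assumes "is_permutation \<alpha>" "\<alpha> \<noteq> []" "is_permutation \<beta>" "indecomposable \<alpha>'" "dsum \<alpha> \<beta> = dsum \<alpha>' \<beta>'"
  shows "length \<alpha>' \<le> length \<alpha>"
proof (rule ccontr)
  assume "\<not> length \<alpha>' \<le> length \<alpha>"
  then have lt: "length \<alpha> < length \<alpha>'" by simp
  then obtain i j where ij: "i < length \<alpha>" "length \<alpha> \<le> j" "j < length \<alpha>'" "\<alpha>' ! j \<le> \<alpha>' ! i"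
    using assms(2,4) unfolding indecomposable_def by (metis length_greater_0_conv)
  have len: "length \<alpha> + length \<beta> = length \<alpha>' + length \<beta>'"
    using arg_cong[OF assms(5), of length] by simp
  have "\<alpha>' ! i = \<alpha> ! i" using arg_cong[OF assms(5), of "\<lambda>l. l ! i"] ij len by (simp add: nth_dsum)
  moreover have "\<alpha>' ! j = \<beta> ! (j - length \<alpha>) + length \<alpha>"
    using arg_cong[OF assms(5), of "\<lambda>l. l ! j"] ij len by (simp add: nth_dsum)
  moreover have "\<alpha> ! i \<le> length \<alpha>" "1 \<le> \<beta> ! (j - length \<alpha>)"
    using nth_permutation_bounds[OF assms(1), of i] nth_permutation_bounds[OF assms(3), of "j - length \<alpha>"]
      ij len by auto
  ultimately show False using ij(4) by simp
qed

lemma dsum_inject: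
  assumes "indecomposable \<alpha>" "is_permutation \<beta>" "indecomposable \<alpha>'" "is_permutation \<beta>'"
    "dsum \<alpha> \<beta> = dsum \<alpha>' \<beta>'"
  shows "\<alpha> = \<alpha>' \<and> \<beta> = \<beta>'"
proof -
  have "length \<alpha> = length \<alpha>'"
    using dsum_inject_aux[of \<alpha> \<beta> \<alpha>' \<beta>'] dsum_inject_aux[of \<alpha>' \<beta>' \<alpha> \<beta>] assms
    unfolding indecomposable_def by (metis le_antisym)
  moreover from this have "\<alpha> = \<alpha>'" and "map (\<lambda>v. v + length \<alpha>) \<beta> = map (\<lambda>v. v + length \<alpha>) \<beta>'"
    using assms(5) by (simp_all add: dsum_def)
  ultimately show ?thesis by (metis add_right_cancel injI inj_map_eq_map)
qed

lemma contains_dsum_left: "contains (dsum \<alpha> \<beta>) \<alpha>"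
  unfolding contains_iff
  by (intro exI[of _ "\<lambda>i. i"]) (auto simp: strict_mono_on_def nth_dsum)

lemma contains_dsum_right: "contains (dsum \<alpha> \<beta>) \<beta>"
  unfolding contains_iff
  by (intro exI[of _ "\<lambda>i. i + length \<alpha>"]) (auto simp: strict_mono_on_def nth_dsum)

text \<open>An occurrence that meets both summands is cut where it passes from
  \<open>\<alpha>\<close> to \<open>\<beta>\<close>, and no inversion crosses this cut.\<close>

lemma indecomposable_contains_dsum:
  assumes ind: "indecomposable \<tau>" and \<alpha>: "is_permutation \<alpha>" and \<beta>: "is_permutation \<beta>"
    and c: "contains (dsum \<alpha> \<beta>) \<tau>"
  shows "contains \<alpha> \<tau> \<or> contains \<beta> \<tau>"
proof -
  obtain f where f: "strict_mono_on {..<length \<tau>} f" "\<forall>i<length \<tau>. f i < length \<alpha> + length \<beta>"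
     "\<forall>i<length \<tau>. \<forall>j<length \<tau>. dsum \<alpha> \<beta> ! f i < dsum \<alpha> \<beta> ! f j \<longleftrightarrow> \<tau> ! i < \<tau> ! j"
    using c by (auto simp: contains_iff)
  have mono: "f i < f j" if "i < j" "j < length \<tau>" for i j
    using f(1) that by (auto simp: strict_mono_on_def)
  consider "\<forall>i<length \<tau>. f i < length \<alpha>" | "\<forall>i<length \<tau>. length \<alpha> \<le> f i"
    | i j where "i < length \<tau>" "j < length \<tau>" "f i < length \<alpha>" "length \<alpha> \<le> f j"
    by (meson not_less)
  then show ?thesis
  proof cases
    case 1
    then have "contains \<alpha> \<tau>" unfolding contains_iff using f
      by (intro exI[of _ f]) (simp add: nth_dsum)
    then show ?thesis ..
  next
    case 2
    then have "contains \<beta> \<tau>" unfolding contains_iff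
    proof (intro exI[of _ "\<lambda>i. f i - length \<alpha>"] conjI)
      show "strict_mono_on {..<length \<tau>} (\<lambda>i. f i - length \<alpha>)"
        using f(1) 2 by (auto simp: strict_mono_on_def intro!: diff_less_mono)
      show "\<forall>i<length \<tau>. f i - length \<alpha> < length \<beta>" using f(2) 2 by (auto simp: less_diff_conv2)
      show "\<forall>i<length \<tau>. \<forall>j<length \<tau>. \<beta> ! (f i - length \<alpha>) < \<beta> ! (f j - length \<alpha>) \<longleftrightarrow> \<tau> ! i < \<tau> ! j"
        using f(2,3) 2 by (simp add: nth_dsum not_less[symmetric])
    qed
    then show ?thesis ..
  next
    case (3 i j)
    \<comment> \<open>The first position of the pattern that is sent into
      \<open>\<beta>\<close>.\<close>
    define k where "k = (LEAST k. k < length \<tau> \<and> length \<alpha> \<le> f k)"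
    have k: "k < length \<tau>" "length \<alpha> \<le> f k"
      using LeastI[of "\<lambda>k. k < length \<tau> \<and> length \<alpha> \<le> f k" j] 3 unfolding k_def by auto
    have below: "f i < length \<alpha>" if "i < k" for i
      using not_less_Least[of i "\<lambda>k. k < length \<tau> \<and> length \<alpha> \<le> f k"] that k unfolding k_def[symmetric] by auto
    have above: "length \<alpha> \<le> f i" if "k \<le> i" "i < length \<tau>" for i
      using mono[of k i] that k by (cases "i = k") auto
    have "0 < k" using above[of i] 3 by (cases "k = 0") auto
    then obtain i j where ij: "i < k" "k \<le> j" "j < length \<tau>" "\<tau> ! j \<le> \<tau> ! i"
      using ind k unfolding indecomposable_def by blast
    have "dsum \<alpha> \<beta> ! f i \<le> length \<alpha>"
      using below[OF ij(1)] nth_permutation_bounds[OF \<alpha>] by (simp add: nth_dsum)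
    also have "\<dots> < dsum \<alpha> \<beta> ! f j"
      using above[OF ij(2,3)] nth_permutation_bounds[OF \<beta>, of "f j - length \<alpha>"] f(2)[rule_format, OF ij(3)]
      by (simp add: nth_dsum less_diff_conv2 Suc_le_eq add.commute)
    finally have "\<tau> ! i < \<tau> ! j" using f(3) ij k by simp
    then show ?thesis using ij(4) by simp
  qed
qed

lemma contains_refl: "contains \<pi> \<pi>"
  unfolding contains_iff by (intro exI[of _ "\<lambda>i. i"]) (auto simp: strict_mono_on_def)

lemma dsum_in_sum_class:
  assumes "\<And>\<alpha> \<tau>. \<alpha> \<in> I \<Longrightarrow> indecomposable \<tau> \<Longrightarrow> contains \<alpha> \<tau> \<Longrightarrow> \<tau> \<in> I"
    and "indecomposable \<alpha>" "is_permutation \<beta>"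
  shows "dsum \<alpha> \<beta> \<in> sum_class I \<longleftrightarrow> \<alpha> \<in> I \<and> \<beta> \<in> sum_class I"
proof -
  have a: "is_permutation \<alpha>" using assms(2) by (simp add: indecomposable_def)
  have "contains (dsum \<alpha> \<beta>) \<tau> \<longleftrightarrow> contains \<alpha> \<tau> \<or> contains \<beta> \<tau>" if "indecomposable \<tau>" for \<tau>
    using indecomposable_contains_dsum[OF that a assms(3)] contains_trans
      contains_dsum_left contains_dsum_right by blast
  then show ?thesis
    unfolding sum_class_def using assms is_permutation_dsum[OF a assms(3)] contains_refl by blast
qed

section \<open>The recurrence for the counting sequence of a sum closed class\<close>

lemma finite_of_length:
  assumes "\<forall>\<pi>\<in>C. is_permutation \<pi>"
  shows "finite (of_length C n)"
  by (rule finite_subset[OF _ finite_permutations[of n]]) (use assms in \<open>auto simp: of_length_def\<close>)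

lemma sum_class_permutation: "\<forall>\<pi>\<in>sum_class I. is_permutation \<pi>"
  by (simp add: sum_class_def)

lemma card_sum_class_0: "card (of_length (sum_class I) 0) = 1"
proof -
  have "[] \<in> sum_class I"
    using contains_length_le by (fastforce simp: sum_class_def is_permutation_iff indecomposable_def)
  then have "of_length (sum_class I) 0 = {[]}" by (auto simp: of_length_def)
  then show ?thesis by simp
qed

text \<open>Each nonempty member splits off its first indecomposable summand in exactly one way;
  \<open>k\<close> is the length of that summand.\<close>

lemma card_sum_class_rec:
  assumes dn: "\<And>\<alpha> \<tau>. \<alpha> \<in> I \<Longrightarrow> indecomposable \<tau> \<Longrightarrow> contains \<alpha> \<tau> \<Longrightarrow> \<tau> \<in> I"
    and I: "\<forall>\<alpha>\<in>I. indecomposable \<alpha>" and n: "n > 0"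
  shows "card (of_length (sum_class I) n) =
     (\<Sum>k=1..n. card (of_length I k) * card (of_length (sum_class I) (n - k)))"
proof -
  let ?C = "sum_class I"
  let ?B = "\<lambda>k. (\<lambda>(\<alpha>, \<beta>). dsum \<alpha> \<beta>) ` (of_length I k \<times> of_length ?C (n - k))"
  have perm: "\<beta> \<in> ?C \<Longrightarrow> is_permutation \<beta>" for \<beta> by (simp add: sum_class_def)
  have Iperm: "\<forall>\<alpha>\<in>I. is_permutation \<alpha>" using I by (simp add: indecomposable_def)
  have fin: "finite (?B k)" for k
    by (intro finite_imageI finite_cartesian_product finite_of_length sum_class_permutation Iperm)
  have inj: "inj_on (\<lambda>(\<alpha>, \<beta>). dsum \<alpha> \<beta>) (I \<times> ?C)"
  proof (rule inj_onI, clarify)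
    fix \<alpha> \<beta> \<alpha>' \<beta>' assume "\<alpha> \<in> I" "\<beta> \<in> ?C" "\<alpha>' \<in> I" "\<beta>' \<in> ?C" "dsum \<alpha> \<beta> = dsum \<alpha>' \<beta>'"
    then show "\<alpha> = \<alpha>' \<and> \<beta> = \<beta>'" using dsum_inject[of \<alpha> \<beta> \<alpha>' \<beta>'] I perm by simp
  qed
  have "of_length ?C n = (\<Union>k\<in>{1..n}. ?B k)"
  proof (intro equalityI subsetI)
    fix \<pi> assume "\<pi> \<in> of_length ?C n"
    then have \<pi>: "\<pi> \<in> ?C" "length \<pi> = n" by (auto simp: of_length_def)
    then obtain \<alpha> \<beta> where ab: "indecomposable \<alpha>" "is_permutation \<beta>" "\<pi> = dsum \<alpha> \<beta>"
      using ex_indecomposable_dsum[of \<pi>] perm n by auto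
    then have "\<alpha> \<in> I" "\<beta> \<in> ?C" using dsum_in_sum_class[OF dn ab(1,2)] \<pi> by auto
    moreover have "length \<alpha> \<in> {1..n}" "length \<beta> = n - length \<alpha>"
      using ab \<pi> by (auto simp: indecomposable_def Suc_le_eq)
    ultimately show "\<pi> \<in> (\<Union>k\<in>{1..n}. ?B k)"
      using ab(3) by (intro UN_I[of "length \<alpha>"]) (auto simp: of_length_def)
  next
    fix \<pi> assume "\<pi> \<in> (\<Union>k\<in>{1..n}. ?B k)"
    then obtain k \<alpha> \<beta> where k: "k \<in> {1..n}" "\<alpha> \<in> I" "length \<alpha> = k" "\<beta> \<in> ?C" "length \<beta> = n - k" "\<pi> = dsum \<alpha> \<beta>"
      by (auto simp: of_length_def)
    then show "\<pi> \<in> of_length ?C n"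
      using dsum_in_sum_class[OF dn, where \<alpha> = \<alpha> and \<beta> = \<beta>] I perm by (auto simp: of_length_def)
  qed
  also have "card \<dots> = (\<Sum>k=1..n. card (?B k))"
  proof (rule card_UN_disjoint)
    show "\<forall>i\<in>{1..n}. \<forall>j\<in>{1..n}. i \<noteq> j \<longrightarrow> ?B i \<inter> ?B j = {}"
    proof (intro ballI impI)
      fix i j :: nat assume "i \<noteq> j"
      show "?B i \<inter> ?B j = {}"
      proof (rule ccontr)
        assume "?B i \<inter> ?B j \<noteq> {}"
        then obtain \<alpha> \<beta> \<alpha>' \<beta>' where h: "\<alpha> \<in> I" "length \<alpha> = i" "\<beta> \<in> ?C"
          "\<alpha>' \<in> I" "length \<alpha>' = j" "\<beta>' \<in> ?C" "dsum \<alpha> \<beta> = dsum \<alpha>' \<beta>'"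
          by (auto simp: of_length_def)
        then have "\<alpha> = \<alpha>'" using dsum_inject[of \<alpha> \<beta> \<alpha>' \<beta>'] I perm by blast
        then show False using h \<open>i \<noteq> j\<close> by simp
      qed
    qed
  qed (use fin in auto)
  also have "\<dots> = (\<Sum>k=1..n. card (of_length I k) * card (of_length ?C (n - k)))"
  proof (rule sum.cong)
    fix k
    have "card (?B k) = card (of_length I k \<times> of_length ?C (n - k))"
      by (rule card_image, rule inj_on_subset[OF inj]) (auto simp: of_length_def)
    then show "card (?B k) = card (of_length I k) * card (of_length ?C (n - k))"
      by (simp add: card_cartesian_product)
  qed simp
  finally show ?thesis .
qed

section \<open>Growth rates from the renewal equation\<close>

text \<open>The upper bound is an induction. For the lower bound, the tails \<open>T j\<close> of
  the distribution \<open>p\<close> satisfy the conservation law \<open>id\<close>. As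
  \<open>T\<close> is summable, lags from some \<open>J\<close> on contribute less than one half, so
  among the last \<open>J\<close> values one is at least \<open>1 / (2 * S)\<close>; the positive
  probability \<open>p 1\<close> carries it on to \<open>n\<close> at bounded loss.\<close>

lemma renewal_bounds:
  fixes u p :: "nat \<Rightarrow> real"
  assumes u0: "u 0 = 1" and rec: "\<And>n. n > 0 \<Longrightarrow> u n = (\<Sum>k=1..n. p k * u (n - k))"
    and p: "\<And>k. p k \<ge> 0" "p 0 = 0" "p 1 > 0" and sums: "p sums 1"
    and geo: "\<And>k. p k \<le> M * q ^ k" "0 < q" "q < 1"
  obtains c where "c > 0" "\<And>n. c \<le> u n" "\<And>n. u n \<le> 1"
proof -
  define T where "T = (\<lambda>j. 1 - (\<Sum>k\<le>j. p k))"
  have psum: "(\<Sum>k\<le>n. p k) \<le> 1" for n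
    using sums p(1) by (metis finite_atMost sum_le_suminf sums_iff)
  have T0: "T j \<ge> 0" for j using psum by (simp add: T_def)
  have upos: "u n \<ge> 0" for n
  proof (induction n rule: less_induct)
    case (less n)
    then show ?case using u0 rec[of n] p(1)
      by (cases "n = 0") (auto intro!: sum_nonneg mult_nonneg_nonneg)
  qed
  \<comment> \<open>From \<open>n\<close> to \<open>Suc n\<close> the new term
    \<open>u (Suc n) * T 0\<close> enters, where \<open>T 0 = 1\<close>, and replacing each
    \<open>T j\<close> by \<open>T (Suc j)\<close> loses the same amount by the renewal
    equation.\<close>
  have id: "(\<Sum>j\<le>n. u (n - j) * T j) = 1" for n
  proof (induction n)
    case 0
    then show ?case by (simp add: T_def u0 p)
  next
    case (Suc n)
    have "(\<Sum>j\<le>Suc n. u (Suc n - j) * T j) = u (Suc n) * T 0 + (\<Sum>j\<le>n. u (n - j) * T (Suc j))"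
      by (subst sum.atMost_Suc_shift) simp
    also have "(\<Sum>j\<le>n. u (n - j) * T (Suc j)) = (\<Sum>j\<le>n. u (n - j) * T j) - (\<Sum>j\<le>n. p (Suc j) * u (n - j))"
      by (simp add: T_def algebra_simps sum.distrib flip: sum_subtractf)
    also have "(\<Sum>j\<le>n. p (Suc j) * u (n - j)) = u (Suc n)"
    proof -
      have "u (Suc n) = (\<Sum>k=1..Suc n. p k * u (Suc n - k))" by (rule rec) simp
      also have "\<dots> = (\<Sum>j=0..n. p (Suc j) * u (n - j))"
        using sum.shift_bounds_cl_Suc_ivl[of "\<lambda>k. p k * u (Suc n - k)" 0 n] by simp
      finally show ?thesis by (simp add: atMost_atLeast0)
    qed
    finally show ?case using Suc p by (simp add: T_def)
  qed
  have u1: "u n \<le> 1" for n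
  proof (induction n rule: less_induct)
    case (less n)
    show ?case
    proof (cases "n = 0")
      case False
      have "u n = (\<Sum>k=1..n. p k * u (n - k))" using False rec by simp
      also have "\<dots> \<le> (\<Sum>k=1..n. p k * 1)"
        using less p(1) by (intro sum_mono mult_left_mono) auto
      also have "\<dots> \<le> (\<Sum>k\<le>n. p k)" using p(1) by (simp, intro sum_mono2) auto
      finally show ?thesis using psum[of n] by simp
    qed (simp add: u0)
  qed
  \<comment> \<open>Geometric domination of \<open>p\<close> passes to its tails and makes
    \<open>T\<close> summable, that is, gives \<open>p\<close> a finite mean.\<close>
  have Tgeo: "T j \<le> M / (1 - q) * q ^ Suc j" for j
  proof -
    have "T j = (\<Sum>k. p (k + Suc j))"
      using suminf_minus_initial_segment[of p "Suc j"] sums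
      by (simp add: T_def sums_iff lessThan_Suc_atMost)
    also have "\<dots> \<le> (\<Sum>k. M * q ^ Suc j * q ^ k)"
    proof (rule suminf_le)
      show "p (k + Suc j) \<le> M * q ^ Suc j * q ^ k" for k
        using geo(1)[of "k + Suc j"] by (simp add: power_add mult_ac)
      show "summable (\<lambda>k. p (k + Suc j))" using sums by (subst summable_iff_shift) (simp add: sums_iff)
      show "summable (\<lambda>k. M * q ^ Suc j * q ^ k)" using geo by (intro summable_mult summable_geometric) auto
    qed
    also have "\<dots> = M * q ^ Suc j * (1 / (1 - q))"
      using geo by (subst suminf_mult) (auto simp: suminf_geometric intro!: summable_geometric)
    finally show ?thesis by simp
  qed
  have sumT: "summable T"
    by (rule summable_comparison_test'[of "\<lambda>j. M / (1 - q) * q ^ Suc j" 0])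
       (use geo T0 Tgeo in \<open>auto intro!: summable_mult summable_mult2 summable_geometric simp: mult.assoc\<close>)
  define S where "S = suminf T"
  obtain J where J: "norm (\<Sum>j. T (j + J)) < 1/2"
    using suminf_exist_split[OF _ sumT, of "1/2"] by force
  have tail: "(\<Sum>j\<in>{J..n}. T j) < 1/2" for n
  proof -
    have "(\<Sum>j\<in>{J..n}. T j) \<le> (\<Sum>j\<in>{..<Suc n}. T (j + J))"
    proof -
      have "(\<Sum>j\<in>{J..n}. T j) \<le> (\<Sum>j\<in>{0+J..<Suc n+J}. T j)" by (intro sum_mono2) (auto simp: T0)
      also have "\<dots> = (\<Sum>j\<in>{0..<Suc n}. T (j + J))" by (rule sum.shift_bounds_nat_ivl)
      finally show ?thesis by (simp only: atLeast0LessThan)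
    qed
    also have "\<dots> \<le> (\<Sum>j. T (j + J))"
      using sumT T0 by (intro sum_le_suminf) (auto simp: summable_iff_shift)
    finally show ?thesis using J by (simp add: abs_less_iff)
  qed
  have S1: "S \<ge> 1" using sum_le_suminf[OF sumT, of "{0}"] T0 by (simp add: S_def T_def p)
  \<comment> \<open>Keeps only the summand \<open>k = 1\<close> of the renewal equation at each
    step.\<close>
  have ustep: "u (n + m) \<ge> p 1 ^ m * u n" for n m
  proof (induction m)
    case (Suc m)
    have "p 1 * u (n + m) \<le> (\<Sum>k=1..Suc (n+m). p k * u (Suc (n+m) - k))"
      using member_le_sum[of 1 "{1..Suc (n+m)}" "\<lambda>k. p k * u (Suc (n+m) - k)"] p(1) upos by simp
    then have "p 1 * u (n + m) \<le> u (n + Suc m)" using rec[of "n + Suc m"] by simp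
    moreover have "p 1 * (p 1 ^ m * u n) \<le> p 1 * u (n + m)" using Suc p by (intro mult_left_mono) auto
    ultimately show ?case by (simp add: mult.assoc)
  qed simp
  \<comment> \<open>At most \<open>J\<close> steps, each costing a factor \<open>p 1\<close>, from a
    value of at least \<open>1 / (2 * S)\<close>.\<close>
  define c where "c = p 1 ^ J / (2 * S)"
  have p1: "p 1 \<le> 1" using psum[of 1] p(2) by (simp)
  have low: "c \<le> u n" for n
  proof -
    have "\<exists>j\<le>n. j < J \<and> u (n - j) \<ge> 1 / (2 * S)"
    proof (rule ccontr)
      assume "\<not> ?thesis"
      then have lt: "u (n - j) < 1 / (2 * S)" if "j \<le> n" "j < J" for j using that by (auto simp: not_le)
      have "(\<Sum>j\<le>n. u (n - j) * T j) = (\<Sum>j\<in>{..n} \<inter> {..<J}. u (n - j) * T j) + (\<Sum>j\<in>{..n} \<inter> {J..}. u (n - j) * T j)"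
        by (subst sum.union_disjoint[symmetric]) (auto intro!: sum.cong)
      also have "(\<Sum>j\<in>{..n} \<inter> {J..}. u (n - j) * T j) \<le> (\<Sum>j\<in>{J..n}. 1 * T j)"
      proof -
        have "{..n} \<inter> {J..} = {J..n}" by auto
        then show ?thesis by (simp only:) (intro sum_mono mult_right_mono u1 T0)
      qed
      also have "(\<Sum>j\<in>{..n} \<inter> {..<J}. u (n - j) * T j) \<le> (\<Sum>j\<in>{..n} \<inter> {..<J}. 1 / (2 * S) * T j)"
        using lt T0 by (intro sum_mono mult_right_mono) (auto intro: less_imp_le)
      also have "\<dots> \<le> 1 / (2 * S) * S"
        unfolding sum_distrib_left[symmetric] using S1 sumT T0
        by (intro mult_left_mono) (auto simp: S_def intro!: sum_le_suminf)
      finally have "1 \<le> 1 / (2 * S) * S + (\<Sum>j\<in>{J..n}. T j)" using id by simp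
      then show False using tail[of n] S1 by simp
    qed
    then obtain j where j: "j \<le> n" "j < J" "u (n - j) \<ge> 1 / (2 * S)" by blast
    have "c \<le> p 1 ^ j * (1 / (2 * S))"
      unfolding c_def using S1 p1 p(3) j(2) by (simp add: divide_right_mono power_decreasing)
    also have "\<dots> \<le> p 1 ^ j * u (n - j)" using j(3) p(3) by (intro mult_left_mono) auto
    also have "\<dots> \<le> u n" using ustep[of j "n - j"] j(1) by simp
    finally show ?thesis .
  qed
  show thesis using that[of c] low u1 S1 p(3) by (simp add: c_def)
qed

lemma has_growth_rate_sandwich:
  assumes "c > 0" "g > 0" "\<And>n. c * g ^ n \<le> real (card (of_length C n))" "\<And>n. real (card (of_length C n)) \<le> g ^ n"
  shows "has_growth_rate C g"
  unfolding has_growth_rate_def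
proof (rule tendsto_sandwich)
  have "(\<lambda>n. root n c * g) \<longlonglongrightarrow> 1 * g"
    using assms(1) by (intro tendsto_mult LIMSEQ_root_const tendsto_const)
  then show "(\<lambda>n. root n c * g) \<longlonglongrightarrow> g" by simp
  show "\<forall>\<^sub>F n in sequentially. root n c * g \<le> root n (real (card (of_length C n)))"
  proof (rule eventually_sequentiallyI[of 1])
    fix n :: nat assume n: "n \<ge> 1"
    have "root n c * g = root n (c * g ^ n)"
      using n assms by (simp add: real_root_mult real_root_power_cancel)
    also have "\<dots> \<le> root n (real (card (of_length C n)))" using n assms by simp
    finally show "root n c * g \<le> root n (real (card (of_length C n)))" .
  qed
  show "\<forall>\<^sub>F n in sequentially. root n (real (card (of_length C n))) \<le> g"
  proof (rule eventually_sequentiallyI[of 1])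
    fix n :: nat assume n: "n \<ge> 1"
    have "root n (real (card (of_length C n))) \<le> root n (g ^ n)" using n assms by simp
    also have "\<dots> = g" using n assms by (simp add: real_root_power_cancel)
    finally show "root n (real (card (of_length C n))) \<le> g" .
  qed
qed simp

text \<open>Dividing the counts by \<open>g ^ n\<close> turns the recurrence into a renewal
  equation. Boundedness of the counts supplies the geometric domination, and
  \<open>[1] \<in> I\<close> supplies \<open>p 1 > 0\<close>.\<close>

lemma sum_class_growth_rate:
  assumes dn: "\<And>\<alpha> \<tau>. \<alpha> \<in> I \<Longrightarrow> indecomposable \<tau> \<Longrightarrow> contains \<alpha> \<tau> \<Longrightarrow> \<tau> \<in> I"
    and I: "\<forall>\<alpha>\<in>I. indecomposable \<alpha>" and I1: "[1] \<in> I"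
    and g: "g > 1" and sums: "(\<lambda>n. real (card (of_length I n)) * (1 / g) ^ n) sums 1"
    and bound: "\<And>n. card (of_length I n) \<le> M"
  shows "has_growth_rate (sum_class I) g"
proof -
  define u where "u = (\<lambda>n. real (card (of_length (sum_class I) n)) * (1 / g) ^ n)"
  define p where "p = (\<lambda>n. real (card (of_length I n)) * (1 / g) ^ n)"
  have fin: "finite (of_length I n)" for n
    by (rule finite_of_length) (use I in \<open>simp add: indecomposable_def\<close>)
  have I0: "of_length I 0 = {}" using I by (auto simp: of_length_def indecomposable_def)
  have "[1] \<in> of_length I 1" using I1 by (simp add: of_length_def)
  then have card1: "card (of_length I 1) > 0" using fin[of 1] by (auto simp: card_gt_0_iff)
  have step: "real (card (of_length I k) * card (of_length (sum_class I) (n - k))) * (1 / g) ^ n =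
         real (card (of_length I k)) * (1 / g) ^ k *
         (real (card (of_length (sum_class I) (n - k))) * (1 / g) ^ (n - k))" if "k \<in> {1..n}" for k n
  proof -
    have "(1 / g) ^ n = (1 / g) ^ k * (1 / g) ^ (n - k)" using that by (simp flip: power_add)
    then show ?thesis by simp
  qed
  obtain c where c: "c > 0" "\<And>n. c \<le> u n" "\<And>n. u n \<le> 1"
  proof (rule renewal_bounds[of u p M "1 / g"])
    show "u 0 = 1" by (simp add: u_def card_sum_class_0)
    show "u n = (\<Sum>k=1..n. p k * u (n - k))" if "n > 0" for n
    proof -
      have "card (of_length (sum_class I) n) =
          (\<Sum>k=1..n. card (of_length I k) * card (of_length (sum_class I) (n - k)))"
      proof (rule card_sum_class_rec)
        show "\<tau> \<in> I" if "\<alpha> \<in> I" "indecomposable \<tau>" "contains \<alpha> \<tau>" for \<alpha> \<tau>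
          using dn that .
      qed (fact I, fact that)
      then show ?thesis unfolding u_def p_def by (simp only: of_nat_sum sum_distrib_right) (rule sum.cong[OF refl], rule step, simp)
    qed
    show "p k \<ge> 0" for k using g by (simp add: p_def)
    show "p 0 = 0" by (simp add: p_def I0)
    show "p 1 > 0" using g card1 by (simp add: p_def)
    show "p sums 1" using sums by (simp add: p_def)
    show "p k \<le> real M * (1 / g) ^ k" for k
      unfolding p_def using bound[of k] g by (intro mult_right_mono) auto
    show "0 < 1 / g" "1 / g < 1" using g by auto
  qed blast
  show ?thesis
  proof (rule has_growth_rate_sandwich[of c g])
    show "c * g ^ n \<le> real (card (of_length (sum_class I) n))" for n
      using c(2)[of n] g by (simp add: u_def power_one_over field_simps)
    show "real (card (of_length (sum_class I) n)) \<le> g ^ n" for n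
      using c(3)[of n] g by (simp add: u_def power_one_over field_simps)
  qed (use c g in auto)
qed

text \<open>\<open>T n\<close> plays the role of the total weight available from length
  \<open>n\<close> on. Taking at every length as many items as fit keeps the remainder between 0 and
  \<open>T\<close>: either all \<open>F n\<close> items are used, or the remainder drops below
  \<open>y ^ n\<close>, which \<open>step\<close> says later items can cover.\<close>

lemma greedy_fill:
  fixes y :: real and T :: "nat \<Rightarrow> real" and F :: "nat \<Rightarrow> nat"
  assumes y: "y > 0" and T: "\<And>n. n \<ge> k \<Longrightarrow> T n = real (F n) * y ^ n + T (Suc n)" "T \<longlonglongrightarrow> 0"
    and step: "\<And>n. n \<ge> k \<Longrightarrow> y ^ n \<le> T (Suc n)"
    and \<delta>: "0 \<le> \<delta>" "\<delta> \<le> T k"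
  obtains x :: "nat \<Rightarrow> nat" where "\<And>n. x n \<le> F n" "\<And>n. n < k \<Longrightarrow> x n = 0"
    "(\<lambda>n. real (x n) * y ^ n) sums \<delta>"
proof -
  \<comment> \<open>\<open>R i\<close> is what is left of \<open>\<delta>\<close> before length
    \<open>k + i\<close> is treated, and \<open>z i\<close> the number of items taken there.\<close>
  define R where "R = rec_nat \<delta> (\<lambda>i r. r - real (min (F (k+i)) (nat \<lfloor>r / y ^ (k+i)\<rfloor>)) * y ^ (k+i))"
  define z where "z = (\<lambda>i. min (F (k+i)) (nat \<lfloor>R i / y ^ (k+i)\<rfloor>))"
  have R0: "R 0 = \<delta>" by (simp add: R_def)
  have RS: "R (Suc i) = R i - real (z i) * y ^ (k+i)" for i by (simp add: R_def z_def)
  have inv: "0 \<le> R i \<and> R i \<le> T (k + i)" for i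
  proof (induction i)
    case 0
    then show ?case using \<delta> R0 by simp
  next
    case (Suc i)
    let ?w = "y ^ (k+i)"
    have w: "?w > 0" using y by simp
    have fl: "real (nat \<lfloor>R i / ?w\<rfloor>) \<le> R i / ?w" using Suc w by simp
    have "real (z i) \<le> R i / ?w" using fl by (simp add: z_def)
    then have "real (z i) * ?w \<le> R i" using w by (simp add: field_simps)
    moreover have "R (Suc i) \<le> T (k + Suc i)"
    proof (cases "F (k+i) \<le> nat \<lfloor>R i / ?w\<rfloor>")
      case True
      then have "z i = F (k+i)" by (simp add: z_def)
      then show ?thesis using RS[of i] T(1)[of "k+i"] Suc by simp
    next
      case False
      then have "z i = nat \<lfloor>R i / ?w\<rfloor>" by (simp add: z_def)
      moreover have "R i / ?w < real (nat \<lfloor>R i / ?w\<rfloor>) + 1" using Suc w by linarith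
      ultimately have "R i < (real (z i) + 1) * ?w" using w by (simp add: field_simps)
      then have "R (Suc i) < ?w" unfolding RS by (simp add: algebra_simps)
      then show ?thesis using step[of "k+i"] by simp
    qed
    ultimately show ?case by (simp add: RS)
  qed
  have "(\<lambda>i. T (k + i)) \<longlonglongrightarrow> 0" using LIMSEQ_ignore_initial_segment[OF T(2), of k] by (simp add: add.commute)
  then have R: "R \<longlonglongrightarrow> 0"
    using inv by (intro tendsto_sandwich[of "\<lambda>_. 0" R sequentially "\<lambda>i. T (k + i)"]) auto
  have part: "(\<Sum>i<n. real (z i) * y ^ (k+i)) = \<delta> - R n" for n
    by (induction n) (simp_all add: R0 RS)
  have "(\<lambda>n. \<delta> - R n) \<longlonglongrightarrow> \<delta> - 0" by (intro tendsto_intros R)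
  then have sz: "(\<lambda>i. real (z i) * y ^ (k+i)) sums \<delta>" by (simp add: sums_def part)
  define x where "x = (\<lambda>n. if n < k then 0 else z (n - k))"
  show thesis
  proof (rule that)
    show "x n \<le> F n" for n by (simp add: x_def z_def)
    show "x n = 0" if "n < k" for n using that by (simp add: x_def)
    have "(\<lambda>i. real (x (i + k)) * y ^ (i + k)) sums \<delta>" using sz by (simp add: x_def add.commute)
    then have "(\<lambda>n. real (x n) * y ^ n) sums (\<delta> + (\<Sum>i<k. real (x i) * y ^ i))"
      using sums_iff_shift[of "\<lambda>n. real (x n) * y ^ n" k \<delta>] by simp
    then show "(\<lambda>n. real (x n) * y ^ n) sums \<delta>" by (simp add: x_def)
  qed
qed

section \<open>Inflated increasing oscillations\<close>

text \<open>
  Point \<open>i\<close> of the bi-infinite increasing oscillation has coordinates \<open>ox i\<close> and \<open>oy i\<close>; two points form an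
  inversion iff their indices differ by 1. The pair \<open>(i, c)\<close> is the \<open>c\<close>-th point of the inflation of point \<open>i\<close>.
\<close>

definition ox :: "int \<Rightarrow> int" where "ox i = (if even i then i + 1 else i - 1)"
definition oy :: "int \<Rightarrow> int" where "oy i = (if even i then i - 1 else i + 1)"

text \<open>Both keys break ties by the second component in the same direction, so each inflated
  point becomes an increasing block.\<close>

definition hpos :: "int \<times> nat \<Rightarrow> int \<times> nat" where "hpos p = (ox (fst p), snd p)"
definition vpos :: "int \<times> nat \<Rightarrow> int \<times> nat" where "vpos p = (oy (fst p), snd p)"

definition osc :: "int \<Rightarrow> int \<Rightarrow> nat \<Rightarrow> nat \<Rightarrow> (int \<times> nat) set" where
  "osc lo hi a b = {(i, c). lo \<le> i \<and> i \<le> hi \<and> c < (if i = lo then a else if i = hi then b else 1)}"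

abbreviation operm :: "(int \<times> nat) set \<Rightarrow> nat list" where
  "operm \<equiv> perm_of hpos vpos"

lemma ox_eq_iff [simp]: "ox i = ox j \<longleftrightarrow> i = j" unfolding ox_def by presburger
lemma oy_eq_iff [simp]: "oy i = oy j \<longleftrightarrow> i = j" unfolding oy_def by presburger

lemma inj_hpos: "inj_on hpos P" by (auto simp: inj_on_def hpos_def prod_eq_iff)
lemma inj_vpos: "inj_on vpos P" by (auto simp: inj_on_def vpos_def prod_eq_iff)

lemma hpos_less: "hpos p < hpos q \<longleftrightarrow> (if fst p = fst q then snd p < snd q else ox (fst p) < ox (fst q))"
  using ox_eq_iff[of "fst p" "fst q"] by (auto simp: hpos_def less_prod_def le_less simp del: ox_eq_iff)
lemma vpos_less: "vpos p < vpos q \<longleftrightarrow> (if fst p = fst q then snd p < snd q else oy (fst p) < oy (fst q))"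
  using oy_eq_iff[of "fst p" "fst q"] by (auto simp: vpos_def less_prod_def le_less simp del: oy_eq_iff)

lemma ox_oy_less: "i \<noteq> j \<Longrightarrow> (ox i < ox j) \<noteq> (oy i < oy j) \<longleftrightarrow> \<bar>i - j\<bar> = 1"
  unfolding ox_def oy_def by presburger

lemma ox_oy_far: "i + 2 \<le> j \<Longrightarrow> ox i < ox j \<and> oy i < oy j"
  unfolding ox_def oy_def by presburger

text \<open>The inversion graph sees only the first components: it is a path whose vertices are
  blown up to independent sets. Connectivity and degrees of this graph drive what follows.\<close>

lemma inverted_iff: "(hpos p < hpos q) \<noteq> (vpos p < vpos q) \<longleftrightarrow> \<bar>fst p - fst q\<bar> = 1"
  using ox_oy_less[of "fst p" "fst q"] by (auto simp: hpos_less vpos_less)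

lemma finite_osc: "finite (osc lo hi a b)"
proof (rule finite_subset)
  show "osc lo hi a b \<subseteq> {lo..hi} \<times> {..<Suc (a + b)}" by (auto simp: osc_def split: if_splits)
qed auto

lemma card_osc:
  assumes "lo < hi"
  shows "card (osc lo hi a b) = a + b + nat (hi - lo - 1)"
proof -
  have "osc lo hi a b = ({lo} \<times> {..<a} \<union> {hi} \<times> {..<b}) \<union> {lo<..<hi} \<times> {0}"
    using assms by (auto simp: osc_def split: if_splits)
  moreover have "card (({lo} \<times> {..<a} \<union> {hi} \<times> {..<b}) \<union> {lo<..<hi} \<times> {0::nat}) = a + b + nat (hi - lo - 1)"
    using assms by (subst card_Un_disjoint; (subst card_Un_disjoint)?) (auto simp: card_cartesian_product)
  ultimately show ?thesis by simp
qed

lemma is_permutation_operm: "finite P \<Longrightarrow> is_permutation (operm P)"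
  by (simp add: is_permutation_perm_of inj_hpos inj_vpos)

lemma permutation_length_1:
  assumes "is_permutation \<pi>" "length \<pi> = 1"
  shows "\<pi> = [1]"
  using assms by (cases \<pi>) (auto simp: is_permutation_iff)

text \<open>Even shifts respect the parity cases of \<open>ox\<close> and \<open>oy\<close>, so up
  to translation only two values of \<open>lo\<close> have to be considered.\<close>

lemma operm_shift: "operm (osc (lo + 2 * j) (hi + 2 * j) a b) = operm (osc lo hi a b)"
proof (rule perm_of_cong_bij[OF _ finite_osc inj_hpos])
  have "ox (i + 2 * j) = ox i + 2 * j" "oy (i + 2 * j) = oy i + 2 * j" for i by (auto simp: ox_def oy_def)
  then show "hpos (map_prod (\<lambda>i. i + 2 * j) id p) < hpos (map_prod (\<lambda>i. i + 2 * j) id q) \<longleftrightarrow> hpos p < hpos q"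
    "vpos (map_prod (\<lambda>i. i + 2 * j) id p) < vpos (map_prod (\<lambda>i. i + 2 * j) id q) \<longleftrightarrow> vpos p < vpos q" for p q
    by (auto simp: hpos_less vpos_less)
  show "bij_betw (map_prod (\<lambda>i. i + 2 * j) id) (osc lo hi a b) (osc (lo + 2 * j) (hi + 2 * j) a b)"
    by (rule bij_betw_byWitness[where f' = "map_prod (\<lambda>i. i - 2 * j) id"])
       (auto simp: osc_def split: if_splits)
qed

section \<open>Indecomposable patterns of inflated oscillations\<close>

text \<open>The points of \<open>A\<close> occupy exactly the first \<open>card A\<close> positions,
  and no inversion crosses the cut there.\<close>

lemma not_indecomposable_split:
  assumes fin: "finite P" and inj: "inj_on X P" and P: "P = A \<union> B" "A \<noteq> {}" "B \<noteq> {}"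
    and sep: "\<And>p q. p \<in> A \<Longrightarrow> q \<in> B \<Longrightarrow> X p < X q \<and> Y p < Y q"
  shows "\<not> indecomposable (perm_of X Y P)"
proof -
  have finA: "finite A" and finB: "finite B" using fin P by auto
  have dis: "A \<inter> B = {}" using sep by fastforce
  have "card P = card A + card B" using P finA finB dis by (simp add: card_Un_disjoint)
  moreover have "card A > 0" "card B > 0" using P finA finB by (auto simp: card_gt_0_iff)
  ultimately have k: "0 < card A" "card A < card P" by auto
  have rA: "rank X P p < card A" if "p \<in> A" for p
  proof -
    have "{q \<in> P. X q < X p} \<subseteq> A"
    proof
      fix q assume "q \<in> {q \<in> P. X q < X p}"
      then show "q \<in> A" using sep[OF that, of q] P(1) by auto
    qed
    moreover have "p \<notin> {q \<in> P. X q < X p}" by simp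
    ultimately have "{q \<in> P. X q < X p} \<subset> A" using that by blast
    then show ?thesis unfolding rank_def using finA by (simp add: psubset_card_mono)
  qed
  have rB: "card A \<le> rank X P p" if "p \<in> B" for p
  proof -
    have "A \<subseteq> {q \<in> P. X q < X p}"
    proof
      fix q assume "q \<in> A"
      then show "q \<in> {q \<in> P. X q < X p}" using sep[OF _ that, of q] P(1) by simp
    qed
    then show ?thesis unfolding rank_def using fin by (intro card_mono) simp_all
  qed
  have "perm_of X Y P ! i < perm_of X Y P ! j" if ilt: "i < card A" and jge: "card A \<le> j" and jlt: "j < card P" for i j
  proof -
    have "i < card P" using ilt k(2) by simp
    then obtain p where p: "p \<in> P" "i = rank X P p" by (rule rank_surj[OF fin inj])
    obtain q where q: "q \<in> P" "j = rank X P q" by (rule rank_surj[OF fin inj jlt])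
    have "p \<in> A" using rB[of p] p ilt P(1) by (meson Un_iff not_le)
    moreover have "q \<in> B" using rA[of q] q jge P(1) by (meson Un_iff not_le)
    ultimately have "Y p < Y q" using sep by blast
    then show ?thesis using p q by (simp add: nth_perm_of fin inj rank_less_iff)
  qed
  then show ?thesis unfolding indecomposable_def using k
    by (metis leD length_perm_of)
qed

text \<open>Renumbering every column by rank closes the gaps left by deleted points without changing
  a comparison.\<close>

lemma operm_compress:
  assumes fin: "finite Q"
  shows "operm Q = operm {(i, c). c < card {d. (i, d) \<in> Q}}"
proof -
  define col where "col = (\<lambda>i. {d. (i, d) \<in> Q})"
  have fc: "finite (col i)" for i
    by (rule finite_subset[of _ "snd ` Q"]) (use fin in \<open>force simp: col_def\<close>)+
  have b: "bij_betw (rank (\<lambda>d. d) (col i)) (col i) {..<card (col i)}" for i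
    by (rule bij_betw_rank) (simp_all add: fc)
  define g where "g = (\<lambda>p. (fst p, rank (\<lambda>d. d) (col (fst p)) (snd p)))"
  have bij: "bij_betw g Q {(i, c). c < card (col i)}"
    unfolding bij_betw_def
  proof
    show "inj_on g Q"
    proof (rule inj_onI)
      fix p q assume pq: "p \<in> Q" "q \<in> Q" "g p = g q"
      then have "fst p = fst q" "rank (\<lambda>d. d) (col (fst p)) (snd p) = rank (\<lambda>d. d) (col (fst p)) (snd q)"
        by (auto simp: g_def)
      moreover have "snd p \<in> col (fst p)" "snd q \<in> col (fst p)"
        using pq(1,2) calculation(1) by (cases p; cases q; simp add: col_def)+
      ultimately show "p = q" using b[of "fst p"] by (auto simp: bij_betw_def inj_on_def prod_eq_iff)
    qed
    show "g ` Q = {(i, c). c < card (col i)}"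
    proof (intro equalityI subsetI)
      fix u assume "u \<in> g ` Q"
      then obtain p where "p \<in> Q" "u = g p" by auto
      then show "u \<in> {(i, c). c < card (col i)}"
        using rank_less_card[OF fc, of "snd p" "fst p"] by (auto simp: g_def col_def)
    next
      fix u assume "u \<in> {(i, c). c < card (col i)}"
      then obtain i c where u: "u = (i, c)" "c < card (col i)" by auto
      then obtain d where "d \<in> col i" "c = rank (\<lambda>d. d) (col i) d"
        using rank_surj[OF fc, of "\<lambda>d. d" i c] by auto
      then show "u \<in> g ` Q" using u by (force simp: g_def col_def)
    qed
  qed
  have key: "rank (\<lambda>d. d) (col i) c < rank (\<lambda>d. d) (col i) d \<longleftrightarrow> c < d" if "(i, c) \<in> Q" "(i, d) \<in> Q" for i c d
    using rank_less_iff[OF fc, of c i d "\<lambda>d. d"] that by (simp add: col_def)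
  have "operm {(i, c). c < card (col i)} = operm Q"
    by (rule perm_of_cong_bij[OF bij fin inj_hpos]) (auto simp: hpos_less vpos_less g_def key)
  then show ?thesis by (simp add: col_def)
qed

text \<open>An empty column between occupied ones would split \<open>Q\<close>, because columns at
  distance at least 2 are ordered alike in both directions. So the occupied columns form an
  interval, and compressing them gives an oscillation. A column with two points must be an original
  end, which is why large \<open>a'\<close> or \<open>b'\<close> pins \<open>lo'\<close> or
  \<open>hi'\<close>.\<close>

lemma indecomposable_sub_osc:
  assumes Q: "Q \<subseteq> osc lo hi a b" and lh: "lo < hi" and ind: "indecomposable (operm Q)"
    and ab: "1 \<le> a" "1 \<le> b"
  shows "operm Q = [1] \<or> (\<exists>lo' hi' a' b'. lo \<le> lo' \<and> lo' < hi' \<and> hi' \<le> hi \<and> 1 \<le> a' \<and> a' \<le> a \<and> 1 \<le> b' \<and> b' \<le> b \<and>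
     (2 \<le> a' \<longrightarrow> lo' = lo) \<and> (2 \<le> b' \<longrightarrow> hi' = hi) \<and> operm Q = operm (osc lo' hi' a' b'))"
proof -
  have fin: "finite Q" using Q finite_osc finite_subset by blast
  have ne: "Q \<noteq> {}" using ind by (auto simp: indecomposable_def perm_of_def)
  define col where "col = (\<lambda>i. {d. (i, d) \<in> Q})"
  have fc: "finite (col i)" for i
    by (rule finite_subset[of _ "snd ` Q"]) (use fin in \<open>force simp: col_def\<close>)+
  define lo' hi' where "lo' = Min (fst ` Q)" and "hi' = Max (fst ` Q)"
  have ends: "lo' \<in> fst ` Q" "hi' \<in> fst ` Q" unfolding lo'_def hi'_def using fin ne by (auto intro!: Min_in Max_in)
  have rng: "lo' \<le> fst p" "fst p \<le> hi'" if "p \<in> Q" for p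
    unfolding lo'_def hi'_def using fin that by auto
  have sub: "lo \<le> lo'" "hi' \<le> hi" using ends Q by (auto simp: osc_def)
  have full: "i \<in> fst ` Q" if "lo' \<le> i" "i \<le> hi'" for i
  proof (rule ccontr)
    assume i: "i \<notin> fst ` Q"
    have "\<not> indecomposable (operm Q)"
    proof (rule not_indecomposable_split[OF fin inj_hpos])
      show "Q = {p \<in> Q. fst p < i} \<union> {p \<in> Q. i < fst p}" using i by force
      have "lo' \<noteq> i" "hi' \<noteq> i" using i ends by auto
      then have "lo' < i" "i < hi'" using that by auto
      then show "{p \<in> Q. fst p < i} \<noteq> {}" "{p \<in> Q. i < fst p} \<noteq> {}" using ends by auto
      show "hpos p < hpos q \<and> vpos p < vpos q" if "p \<in> {p \<in> Q. fst p < i}" "q \<in> {p \<in> Q. i < fst p}" for p q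
        using that ox_oy_far[of "fst p" "fst q"] by (auto simp: hpos_less vpos_less)
    qed
    then show False using ind by simp
  qed
  have colne: "card (col i) \<ge> 1" if "lo' \<le> i" "i \<le> hi'" for i
  proof -
    have "col i \<noteq> {}" using full[OF that] by (auto simp: col_def)
    then show ?thesis using fc[of i] by (simp add: Suc_le_eq card_gt_0_iff)
  qed
  have col0: "col i = {}" if "\<not> (lo' \<le> i \<and> i \<le> hi')" for i using rng that by (fastforce simp: col_def)
  have colle: "card (col i) \<le> (if i = lo then a else if i = hi then b else 1)" for i
  proof -
    have "col i \<subseteq> {..<(if i = lo then a else if i = hi then b else 1)}" using Q by (auto simp: col_def osc_def)
    then show ?thesis using card_mono[of "{..<(if i = lo then a else if i = hi then b else 1)}" "col i"] by simp
  qed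
  show ?thesis
  proof (cases "lo' = hi'")
    case True
    \<comment> \<open>Points of a single column are increasing, so two or more would split off the
      first one.\<close>
    have "card Q = 1"
    proof (rule ccontr)
      assume c: "card Q \<noteq> 1"
      define m where "m = Min (snd ` Q)"
      have "m \<in> snd ` Q" unfolding m_def using fin ne by auto
      then obtain p where p: "p \<in> Q" "snd p = m" by auto
      have mle: "m \<le> snd q" if "q \<in> Q" for q unfolding m_def using fin that by simp
      have fst: "fst q = lo'" if "q \<in> Q" for q using rng[OF that] True by simp
      have "\<not> indecomposable (operm Q)"
      proof (rule not_indecomposable_split[OF fin inj_hpos])
        show "Q = {p} \<union> (Q - {p})" using p by auto
        show "Q - {p} \<noteq> {}" using c p by (metis card.empty card_Suc_Diff1 fin One_nat_def)
        show "hpos u < hpos q \<and> vpos u < vpos q" if "u \<in> {p}" "q \<in> Q - {p}" for u q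
        proof -
          have "m < snd q" using mle[of q] p that fst[of q] fst[of p] by (auto simp: prod_eq_iff le_neq_implies_less)
          then show ?thesis using that p fst by (auto simp: hpos_less vpos_less)
        qed
      qed simp
      then show False using ind by simp
    qed
    then have "operm Q = [1]" using permutation_length_1 ind by (simp add: indecomposable_def)
    then show ?thesis ..
  next
    case False
    have lt: "lo' < hi'" using False ends rng by force
    have eq: "{(i, c). c < card (col i)} = osc lo' hi' (card (col lo')) (card (col hi'))"
    proof -
      have "card (col i) = 1" if "lo' < i" "i < hi'" for i
        using colle[of i] colne[of i] that sub by (auto split: if_splits)
      then have "c < card (col i) \<longleftrightarrow> lo' \<le> i \<and> i \<le> hi' \<and>
          c < (if i = lo' then card (col lo') else if i = hi' then card (col hi') else 1)" for i c
        using col0[of i] lt by (cases "lo' \<le> i \<and> i \<le> hi'") (auto simp: le_less)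
      then show ?thesis by (simp add: osc_def)
    qed
    have "operm Q = operm (osc lo' hi' (card (col lo')) (card (col hi')))"
      using operm_compress[OF fin] eq by (simp add: col_def)
    moreover have "card (col lo') \<le> a" "2 \<le> card (col lo') \<longrightarrow> lo' = lo"
      "card (col hi') \<le> b" "2 \<le> card (col hi') \<longrightarrow> hi' = hi"
      using colle[of lo'] colle[of hi'] lt sub ab lh by (auto split: if_splits)
    moreover have "1 \<le> card (col lo')" "1 \<le> card (col hi')" using colne lt by auto
    ultimately show ?thesis using sub lt by blast
  qed
qed

text \<open>A cut crossed by no inversion leaves adjacent vertices of the inversion graph on the
  same side, but this graph is connected.\<close>

lemma indecomposable_osc:
  assumes lh: "lo < hi" and ab: "1 \<le> a" "1 \<le> b"
  shows "indecomposable (operm (osc lo hi a b))"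
  unfolding indecomposable_def
proof (intro conjI allI impI)
  let ?P = "osc lo hi a b" and ?\<pi> = "operm (osc lo hi a b)"
  show "is_permutation ?\<pi>" by (simp add: is_permutation_operm finite_osc)
  have card: "card ?P = a + b + nat (hi - lo - 1)" by (rule card_osc[OF lh])
  show "?\<pi> \<noteq> []" using card ab by (metis add_is_0 length_perm_of list.size(3) not_one_le_zero)
  fix k assume k: "0 < k \<and> k < length ?\<pi>"
  show "\<exists>i<k. \<exists>j. k \<le> j \<and> j < length ?\<pi> \<and> ?\<pi> ! j \<le> ?\<pi> ! i"
  proof (rule ccontr)
    assume no: "\<not> ?thesis"
    define side where "side = (\<lambda>p. rank hpos ?P p < k)"
    have sep: "hpos p < hpos q \<and> vpos p < vpos q" if "p \<in> ?P" "q \<in> ?P" "side p" "\<not> side q" for p q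
    proof -
      have "?\<pi> ! rank hpos ?P p < ?\<pi> ! rank hpos ?P q"
        using no that(3,4) rank_less_card[OF finite_osc that(2), of hpos] unfolding side_def
        by (metis length_perm_of not_le)
      then have "vpos p < vpos q"
        using that by (simp add: nth_perm_of finite_osc inj_hpos rank_less_iff)
      moreover have "rank hpos ?P p < rank hpos ?P q" using that by (simp add: side_def)
      ultimately show ?thesis using that by (simp add: finite_osc rank_less_iff)
    qed
    have adj: "side p = side q" if "p \<in> ?P" "q \<in> ?P" "\<bar>fst p - fst q\<bar> = 1" for p q
    proof (rule ccontr)
      assume "side p \<noteq> side q"
      then have "\<not> ((hpos p < hpos q) \<noteq> (vpos p < vpos q))" using sep[of p q] sep[of q p] that
        by (metis order.asym)
      then show False using that(3) by (simp only: inverted_iff not_True_eq_False)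
    qed
    have mem: "(i, 0) \<in> ?P" if "lo \<le> i" "i \<le> hi" for i using that ab by (auto simp: osc_def)
    have zero: "side (i, 0) = side (lo, 0)" if "lo \<le> i" "i \<le> hi" for i
      using that
    proof (induction i rule: int_ge_induct)
      case (step i)
      then show ?case using adj[of "(i + 1, 0)" "(i, 0)"] mem by simp
    qed simp
    \<comment> \<open>Further copies in an end column are reached through the neighbouring
      column.\<close>
    have all: "side p = side (lo, 0)" if p: "p \<in> ?P" for p
    proof (cases "fst p = hi")
      case True
      then have "side p = side (hi - 1, 0)" using adj[of p "(hi - 1, 0)"] mem[of "hi - 1"] p lh by simp
      then show ?thesis using zero[of "hi - 1"] lh by simp
    next
      case False
      then have "fst p < hi" "lo \<le> fst p" using p by (auto simp: osc_def)
      then show ?thesis using adj[of p "(fst p + 1, 0)"] mem[of "fst p + 1"] zero[of "fst p + 1"] p by simp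
    qed
    have kk: "0 < card ?P" "k < card ?P" using k by auto
    obtain p where p: "p \<in> ?P" "0 = rank hpos ?P p" by (rule rank_surj[OF finite_osc inj_hpos kk(1)])
    obtain q where q: "q \<in> ?P" "k = rank hpos ?P q" by (rule rank_surj[OF finite_osc inj_hpos kk(2)])
    have "side p" "\<not> side q" using p q k by (auto simp: side_def)
    then show False using all p q by blast
  qed
qed

section \<open>Invariants that tell inflated oscillations apart\<close>

lemma osc_iso:
  assumes eq: "operm (osc lo hi a b) = operm (osc lo' hi' a' b')"
  obtains g where "bij_betw g (osc lo hi a b) (osc lo' hi' a' b')"
    "\<And>p q. p \<in> osc lo hi a b \<Longrightarrow> q \<in> osc lo hi a b \<Longrightarrow> hpos (g p) < hpos (g q) \<longleftrightarrow> hpos p < hpos q"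
    "\<And>p q. p \<in> osc lo hi a b \<Longrightarrow> q \<in> osc lo hi a b \<Longrightarrow> vpos (g p) < vpos (g q) \<longleftrightarrow> vpos p < vpos q"
  using perm_of_eq_imp_bij[OF finite_osc finite_osc inj_hpos inj_hpos eq] by blast

text \<open>By \<open>inverted_iff\<close> this is the degree in the inversion graph, hence
  preserved by order isomorphisms.\<close>

definition deg :: "(int \<times> nat) set \<Rightarrow> int \<times> nat \<Rightarrow> nat" where
  "deg P p = card {q \<in> P. \<bar>fst p - fst q\<bar> = 1}"

lemma deg_iso:
  assumes g: "bij_betw g P Q" and p: "p \<in> P"
    and h: "\<And>p q. p \<in> P \<Longrightarrow> q \<in> P \<Longrightarrow> hpos (g p) < hpos (g q) \<longleftrightarrow> hpos p < hpos q"
    and v: "\<And>p q. p \<in> P \<Longrightarrow> q \<in> P \<Longrightarrow> vpos (g p) < vpos (g q) \<longleftrightarrow> vpos p < vpos q"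
  shows "deg Q (g p) = deg P p"
proof -
  have adj: "\<bar>fst (g p) - fst (g q)\<bar> = 1 \<longleftrightarrow> \<bar>fst p - fst q\<bar> = 1" if "q \<in> P" for q
    using h[OF p that] v[OF p that] by (simp flip: inverted_iff)
  have eq: "g ` {q \<in> P. \<bar>fst p - fst q\<bar> = 1} = {q \<in> Q. \<bar>fst (g p) - fst q\<bar> = 1}"
  proof (intro equalityI subsetI)
    fix u assume "u \<in> {q \<in> Q. \<bar>fst (g p) - fst q\<bar> = 1}"
    moreover then obtain q where "q \<in> P" "u = g q" using bij_betw_imp_surj_on[OF g] by auto
    ultimately show "u \<in> g ` {q \<in> P. \<bar>fst p - fst q\<bar> = 1}" using adj[of q] by auto
  next
    fix u assume "u \<in> g ` {q \<in> P. \<bar>fst p - fst q\<bar> = 1}"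
    then obtain q where "q \<in> P" "u = g q" "\<bar>fst p - fst q\<bar> = 1" by auto
    then show "u \<in> {q \<in> Q. \<bar>fst (g p) - fst q\<bar> = 1}" using adj[of q] bij_betwE[OF g] by auto
  qed
  have "inj_on g {q \<in> P. \<bar>fst p - fst q\<bar> = 1}"
    using bij_betw_imp_inj_on[OF g] by (rule inj_on_subset) auto
  from card_image[OF this] show ?thesis unfolding eq by (simp add: deg_def)
qed

lemma deg_lo: "lo + 2 \<le> hi \<Longrightarrow> deg (osc lo hi a b) (lo, c) = 1"
proof -
  assume "lo + 2 \<le> hi"
  then have "{q \<in> osc lo hi a b. \<bar>fst (lo, c) - fst q\<bar> = 1} = {(lo + 1, 0)}"
    by (auto simp: osc_def)
  then show ?thesis by (simp add: deg_def)
qed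

lemma deg_hi: "lo + 2 \<le> hi \<Longrightarrow> deg (osc lo hi a b) (hi, c) = 1"
proof -
  assume "lo + 2 \<le> hi"
  then have "{q \<in> osc lo hi a b. \<bar>fst (hi, c) - fst q\<bar> = 1} = {(hi - 1, 0)}"
    by (auto simp: osc_def)
  then show ?thesis by (simp add: deg_def)
qed

lemma deg_interior:
  assumes "lo < i" "i < hi" "1 \<le> a" "1 \<le> b"
  shows "2 \<le> deg (osc lo hi a b) (i, c)"
proof -
  have "{(i - 1, 0), (i + 1, 0)} \<subseteq> {q \<in> osc lo hi a b. \<bar>fst (i, c) - fst q\<bar> = 1}"
    using assms by (auto simp: osc_def)
  then have "card {(i - 1, 0::nat), (i + 1, 0)} \<le> deg (osc lo hi a b) (i, c)"
    unfolding deg_def by (intro card_mono finite_subset[OF _ finite_osc]) auto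
  then show ?thesis by simp
qed

text \<open>With at least four columns, column \<open>lo + 2\<close> is interior and has one point,
  so the neighbour of the end block reveals \<open>a\<close>.\<close>

lemma deg_second:
  assumes "lo + 3 \<le> hi"
  shows "deg (osc lo hi a b) (lo + 1, c) = a + 1"
proof -
  have "{q \<in> osc lo hi a b. \<bar>fst (lo + 1, c) - fst q\<bar> = 1} = {lo} \<times> {..<a} \<union> {(lo + 2, 0)}"
    using assms by (auto simp: osc_def split: if_splits)
  moreover have "card ({lo} \<times> {..<a} \<union> {(lo + 2, 0::nat)}) = a + 1"
    by (subst card_Un_disjoint) (auto simp: card_cartesian_product)
  ultimately show ?thesis by (simp add: deg_def)
qed

lemma card_leaves_le:
  assumes "lo < hi" "1 \<le> a" "1 \<le> b"
  shows "card {p \<in> osc lo hi a b. deg (osc lo hi a b) p = 1} \<le> a + b"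
proof -
  have "{p \<in> osc lo hi a b. deg (osc lo hi a b) p = 1} \<subseteq> {lo} \<times> {..<a} \<union> {hi} \<times> {..<b}"
  proof
    fix p assume p: "p \<in> {p \<in> osc lo hi a b. deg (osc lo hi a b) p = 1}"
    have "\<not> (lo < fst p \<and> fst p < hi)"
      using deg_interior[of lo "fst p" hi a b "snd p"] p assms by auto
    then show "p \<in> {lo} \<times> {..<a} \<union> {hi} \<times> {..<b}"
      using p assms(1) by (cases p) (auto simp: osc_def split: if_splits)
  qed
  then have "card {p \<in> osc lo hi a b. deg (osc lo hi a b) p = 1} \<le> card ({lo} \<times> {..<a} \<union> {hi} \<times> {..<b})"
    by (rule card_mono[rotated]) auto
  also have "\<dots> = a + b" using assms(1) by (subst card_Un_disjoint) (auto simp: card_cartesian_product)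
  finally show ?thesis .
qed

lemma card_leaves_ge:
  assumes "lo + 2 \<le> hi"
  shows "a + b \<le> card {p \<in> osc lo hi a b. deg (osc lo hi a b) p = 1}"
proof -
  have "a + b = card ({lo} \<times> {..<a} \<union> {hi} \<times> {..<b})"
    using assms(1) by (subst card_Un_disjoint) (auto simp: card_cartesian_product)
  also have "\<dots> \<le> card {p \<in> osc lo hi a b. deg (osc lo hi a b) p = 1}"
  proof (rule card_mono)
    show "{lo} \<times> {..<a} \<union> {hi} \<times> {..<b} \<subseteq> {p \<in> osc lo hi a b. deg (osc lo hi a b) p = 1}"
      using assms by (auto simp: deg_lo deg_hi) (auto simp: osc_def)
  qed (simp add: finite_osc)
  finally show ?thesis .
qed

text \<open>Compares numbers of leaves of the inversion graph. With three or more columns the leaves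
  are exactly the end points; with two columns \<open>a' + b'\<close> is only an upper bound for
  them, hence an inequality.\<close>

lemma operm_osc_leaves:
  assumes "operm (osc lo hi a b) = operm (osc lo' hi' a' b')" "lo + 2 \<le> hi" "lo' < hi'" "1 \<le> a'" "1 \<le> b'"
  shows "a + b \<le> a' + b'"
proof -
  obtain g where g: "bij_betw g (osc lo hi a b) (osc lo' hi' a' b')"
    "\<And>p q. p \<in> osc lo hi a b \<Longrightarrow> q \<in> osc lo hi a b \<Longrightarrow> hpos (g p) < hpos (g q) \<longleftrightarrow> hpos p < hpos q"
    "\<And>p q. p \<in> osc lo hi a b \<Longrightarrow> q \<in> osc lo hi a b \<Longrightarrow> vpos (g p) < vpos (g q) \<longleftrightarrow> vpos p < vpos q"
    using osc_iso[OF assms(1)] by blast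
  have "card {p \<in> osc lo hi a b. deg (osc lo hi a b) p = 1}
      \<le> card {p \<in> osc lo' hi' a' b'. deg (osc lo' hi' a' b') p = 1}"
  proof (rule card_inj_on_le[of g])
    show "inj_on g {p \<in> osc lo hi a b. deg (osc lo hi a b) p = 1}"
      using bij_betw_imp_inj_on[OF g(1)] by (rule inj_on_subset) auto
    show "g ` {p \<in> osc lo hi a b. deg (osc lo hi a b) p = 1} \<subseteq> {p \<in> osc lo' hi' a' b'. deg (osc lo' hi' a' b') p = 1}"
      using deg_iso[OF g(1) _ g(2,3)] bij_betwE[OF g(1)] by auto
  qed (simp add: finite_osc)
  then show ?thesis using card_leaves_le[OF assms(3-5)] card_leaves_ge[OF assms(2), of a b] by linarith
qed

text \<open>Changing the parity of \<open>lo\<close> inverts the permutation up to isomorphism of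
  the point set, which the inversion graph cannot detect. The leftmost and lowest points break this
  symmetry.\<close>

definition leftmost :: "(int \<times> nat) set \<Rightarrow> int \<times> nat \<Rightarrow> bool" where
  "leftmost P p \<longleftrightarrow> p \<in> P \<and> (\<forall>q\<in>P. \<not> hpos q < hpos p)"
definition lowest :: "(int \<times> nat) set \<Rightarrow> int \<times> nat \<Rightarrow> bool" where
  "lowest P p \<longleftrightarrow> p \<in> P \<and> (\<forall>q\<in>P. \<not> vpos q < vpos p)"

lemma leftmost_unique: "leftmost P p \<Longrightarrow> leftmost P q \<Longrightarrow> p = q"
  using inj_hpos[of P] unfolding leftmost_def inj_on_def by (metis linorder_neqE)
lemma lowest_unique: "lowest P p \<Longrightarrow> lowest P q \<Longrightarrow> p = q"
  using inj_vpos[of P] unfolding lowest_def inj_on_def by (metis linorder_neqE)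

lemma leftmost_osc:
  assumes "lo + 2 \<le> hi" "1 \<le> a"
  shows "leftmost (osc lo hi a b) (if even lo then (lo + 1, 0) else (lo, 0))"
proof -
  let ?m = "(if even lo then (lo + 1, 0) else (lo, 0)) :: int \<times> nat"
  have *: "lo \<le> i \<Longrightarrow> i \<noteq> fst ?m \<Longrightarrow> ox (fst ?m) < ox i" for i unfolding ox_def by (cases "even lo"; simp; presburger)
  have "\<not> hpos q < hpos ?m" if "q \<in> osc lo hi a b" for q
  proof (cases "fst q = fst ?m")
    case False
    moreover have "lo \<le> fst q" using that by (auto simp: osc_def)
    ultimately have "ox (fst ?m) < ox (fst q)" using * by blast
    then show ?thesis using False by (simp add: hpos_less)
  qed (simp add: hpos_less)
  moreover have "?m \<in> osc lo hi a b" using assms by (auto simp: osc_def)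
  ultimately show ?thesis by (simp add: leftmost_def)
qed

lemma lowest_osc:
  assumes "lo + 2 \<le> hi" "1 \<le> a"
  shows "lowest (osc lo hi a b) (if even lo then (lo, 0) else (lo + 1, 0))"
proof -
  let ?m = "(if even lo then (lo, 0) else (lo + 1, 0)) :: int \<times> nat"
  have *: "lo \<le> i \<Longrightarrow> i \<noteq> fst ?m \<Longrightarrow> oy (fst ?m) < oy i" for i unfolding oy_def by (cases "even lo"; simp; presburger)
  have "\<not> vpos q < vpos ?m" if "q \<in> osc lo hi a b" for q
  proof (cases "fst q = fst ?m")
    case False
    moreover have "lo \<le> fst q" using that by (auto simp: osc_def)
    ultimately have "oy (fst ?m) < oy (fst q)" using * by blast
    then show ?thesis using False by (simp add: vpos_less)
  qed (simp add: vpos_less)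
  moreover have "?m \<in> osc lo hi a b" using assms by (auto simp: osc_def)
  ultimately show ?thesis by (simp add: lowest_def)
qed

text \<open>Of the leftmost and the lowest point one lies in column \<open>lo\<close> and the other
  in column \<open>lo + 1\<close>. The leftmost is a leaf exactly for odd \<open>lo\<close>, giving
  the parity; the one in the second column has degree \<open>a + 1\<close>, giving
  \<open>a\<close>.\<close>

lemma operm_osc_inject:
  assumes eq: "operm (osc lo hi a b) = operm (osc lo' hi' a' b')"
    and "lo + 2 \<le> hi" "lo' + 2 \<le> hi'" "1 \<le> a" "1 \<le> a'" "1 \<le> b" "1 \<le> b'"
  shows "even lo = even lo'" "lo + 3 \<le> hi \<Longrightarrow> lo' + 3 \<le> hi' \<Longrightarrow> a = a'"
proof -
  let ?P = "osc lo hi a b" and ?Q = "osc lo' hi' a' b'"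
  obtain g where g: "bij_betw g ?P ?Q"
    "\<And>p q. p \<in> ?P \<Longrightarrow> q \<in> ?P \<Longrightarrow> hpos (g p) < hpos (g q) \<longleftrightarrow> hpos p < hpos q"
    "\<And>p q. p \<in> ?P \<Longrightarrow> q \<in> ?P \<Longrightarrow> vpos (g p) < vpos (g q) \<longleftrightarrow> vpos p < vpos q"
    using osc_iso[OF eq] by blast
  have surj: "?Q = g ` ?P" using bij_betw_imp_surj_on[OF g(1)] by simp
  have L: "leftmost ?Q (g p)" if "leftmost ?P p" for p
    using that g(2) unfolding leftmost_def surj by blast
  have B: "lowest ?Q (g p)" if "lowest ?P p" for p
    using that g(3) unfolding lowest_def surj by blast
  define l where "l = (if even lo then (lo + 1, 0) else (lo, 0::nat))"
  define l' where "l' = (if even lo' then (lo' + 1, 0) else (lo', 0::nat))"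
  define d where "d = (if even lo then (lo, 0) else (lo + 1, 0::nat))"
  define d' where "d' = (if even lo' then (lo', 0) else (lo' + 1, 0::nat))"
  have l: "leftmost ?P l" "leftmost ?Q l'" and d: "lowest ?P d" "lowest ?Q d'"
    unfolding l_def l'_def d_def d'_def using leftmost_osc lowest_osc assms by blast+
  have "g l = l'" "g d = d'" using leftmost_unique L l lowest_unique B d by blast+
  then have deg: "deg ?Q l' = deg ?P l" "deg ?Q d' = deg ?P d"
    using deg_iso[OF g(1) _ g(2,3)] l d unfolding leftmost_def lowest_def by blast+
  have "deg ?P l = 1 \<longleftrightarrow> odd lo"
    using deg_interior[of lo "lo + 1" hi a b 0] deg_lo[OF assms(2), of a b 0] assms by (auto simp: l_def)
  moreover have "deg ?Q l' = 1 \<longleftrightarrow> odd lo'"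
    using deg_interior[of lo' "lo' + 1" hi' a' b' 0] deg_lo[OF assms(3), of a' b' 0] assms by (auto simp: l'_def)
  ultimately show par: "even lo = even lo'" using deg by auto
  assume "lo + 3 \<le> hi" "lo' + 3 \<le> hi'"
  then show "a = a'" using deg par deg_second[of lo hi a b 0] deg_second[of lo' hi' a' b' 0]
    by (auto simp: l_def l'_def d_def d'_def split: if_splits)
qed

section \<open>The base and the fillers\<close>

text \<open>\<open>[1]\<close> is listed separately because the oscillations used here have at least
  two columns.\<close>

definition osc_base :: "nat \<Rightarrow> nat list set" where
  "osc_base s = {\<tau>. indecomposable \<tau> \<and> (\<tau> = [1] \<or> (\<exists>lo hi a b. lo < hi \<and> 1 \<le> a \<and> 1 \<le> b \<and> a + b < s \<and>
     \<tau> = operm (osc lo hi a b)))}"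

text \<open>Three columns make the leaves exactly the end points; ends of size at least 2 cannot
  move inwards without lowering \<open>a + b\<close>.\<close>

definition fillers :: "nat \<Rightarrow> nat \<Rightarrow> nat list set" where
  "fillers s n = {\<tau>. length \<tau> = n \<and> (\<exists>lo hi a b. lo + 2 \<le> hi \<and> 2 \<le> a \<and> 2 \<le> b \<and> a + b = s \<and>
     \<tau> = operm (osc lo hi a b))}"

lemma indecomposable_fillers: "\<tau> \<in> fillers s n \<Longrightarrow> indecomposable \<tau>"
  by (auto simp: fillers_def intro!: indecomposable_osc)

lemma osc_base_closed:
  assumes "\<alpha> \<in> osc_base s" "indecomposable \<tau>" "contains \<alpha> \<tau>"
  shows "\<tau> \<in> osc_base s"
proof (cases "\<alpha> = [1]")
  case True
  then have "length \<tau> = 1" using assms contains_length_le[OF assms(3)]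
    by (cases \<tau>) (auto simp: indecomposable_def)
  then show ?thesis using assms permutation_length_1 by (auto simp: osc_base_def indecomposable_def)
next
  case False
  then obtain lo hi a b where o: "lo < hi" "1 \<le> a" "1 \<le> b" "a + b < s" "\<alpha> = operm (osc lo hi a b)"
    using assms by (auto simp: osc_base_def)
  have pt: "is_permutation \<tau>" using assms(2) by (simp add: indecomposable_def)
  obtain Q where Q: "Q \<subseteq> osc lo hi a b" "\<tau> = operm Q"
    using contains_perm_of[OF finite_osc inj_hpos pt] assms(3) o(5) by blast
  from indecomposable_sub_osc[OF Q(1) o(1)] Q(2) assms(2) o(2,3)
  consider "\<tau> = [1]" | lo' hi' a' b' where "lo' < hi'" "1 \<le> a'" "a' \<le> a" "1 \<le> b'" "b' \<le> b" "\<tau> = operm (osc lo' hi' a' b')"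
    by auto
  then show ?thesis
  proof cases
    case 2
    then have "a' + b' < s" using o(4) by linarith
    then show ?thesis unfolding osc_base_def using 2 assms(2) by blast
  qed (use assms(2) in \<open>auto simp: osc_base_def\<close>)
qed

text \<open>A pattern with \<open>a' + b' = s\<close> keeps both end sizes; these are at least 2 and
  pin both ends, so it is the whole permutation. Thus no filler contains another one.\<close>

lemma fillers_closed:
  assumes "\<alpha> \<in> fillers s n" "indecomposable \<tau>" "contains \<alpha> \<tau>"
  shows "\<tau> = \<alpha> \<or> \<tau> \<in> osc_base s"
proof -
  obtain lo hi a b where o: "lo + 2 \<le> hi" "2 \<le> a" "2 \<le> b" "a + b = s" "\<alpha> = operm (osc lo hi a b)"
    using assms by (auto simp: fillers_def)
  have pt: "is_permutation \<tau>" using assms(2) by (simp add: indecomposable_def)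
  obtain Q where Q: "Q \<subseteq> osc lo hi a b" "\<tau> = operm Q"
    using contains_perm_of[OF finite_osc inj_hpos pt] assms(3) o(5) by blast
  have "lo < hi" "1 \<le> a" "1 \<le> b" using o by auto
  from indecomposable_sub_osc[OF Q(1) this(1) _ this(2,3)] Q(2) assms(2)
  consider "\<tau> = [1]" | lo' hi' a' b' where "lo' < hi'" "1 \<le> a'" "a' \<le> a" "1 \<le> b'" "b' \<le> b"
    "2 \<le> a' \<longrightarrow> lo' = lo" "2 \<le> b' \<longrightarrow> hi' = hi" "\<tau> = operm (osc lo' hi' a' b')"
    by auto
  then show ?thesis
  proof cases
    case 2
    show ?thesis
    proof (cases "a' + b' < s")
      case True
      then show ?thesis unfolding osc_base_def using 2 assms(2) by blast
    next
      case False
      then have "a' = a" "b' = b" using 2 o(4) by linarith+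
      then show ?thesis using 2 o by auto
    qed
  qed (use assms(2) in \<open>auto simp: osc_base_def\<close>)
qed

text \<open>A filler has at least \<open>s\<close> leaves in its inversion graph, a base oscillation
  fewer than \<open>s\<close>.\<close>

lemma fillers_disjoint:
  assumes "4 \<le> s"
  shows "fillers s n \<inter> osc_base s = {}"
proof (rule ccontr)
  assume "fillers s n \<inter> osc_base s \<noteq> {}"
  then obtain \<tau> where \<tau>: "\<tau> \<in> fillers s n" "\<tau> \<in> osc_base s" by auto
  then obtain lo hi a b where o: "lo + 2 \<le> hi" "2 \<le> a" "2 \<le> b" "a + b = s" "\<tau> = operm (osc lo hi a b)"
    by (auto simp: fillers_def)
  have "length \<tau> \<ge> 2" using o card_osc[of lo hi a b] by simp
  then have "\<tau> \<noteq> [1]" by auto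
  then obtain lo' hi' a' b' where "lo' < hi'" "1 \<le> a'" "1 \<le> b'" "a' + b' < s" "\<tau> = operm (osc lo' hi' a' b')"
    using \<tau>(2) by (auto simp: osc_base_def)
  then show False using operm_osc_leaves[of lo hi a b lo' hi' a' b'] o by simp
qed

lemma finite_fillers: "finite (fillers s n)"
  by (rule finite_subset[OF _ finite_permutations[of n]])
     (auto simp: fillers_def intro!: is_permutation_operm finite_osc)

text \<open>At length \<open>s + 1\<close> there is one interior column. The two permutations come
  from the two parities of \<open>lo\<close>; the split of \<open>s\<close> into \<open>2\<close>
  and \<open>s - 2\<close> is an arbitrary choice.\<close>

lemma card_fillers_stars:
  assumes "4 \<le> s"
  shows "2 \<le> card (fillers s (Suc s))"
proof -
  define f where "f = (\<lambda>lo::int. operm (osc lo (lo + 2) 2 (s - 2)))"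
  have "f 0 \<noteq> f 1"
  proof
    have "Suc 0 \<le> s - 2" using assms by simp
    moreover assume "f 0 = f 1"
    ultimately show False
      using operm_osc_inject(1)[of 0 2 2 "s - 2" 1 3 2 "s - 2"] by (simp add: f_def)
  qed
  then have "2 = card {f 0, f 1}" by simp
  also have "{f 0, f 1} \<subseteq> fillers s (Suc s)"
  proof -
    have "f lo \<in> fillers s (Suc s)" for lo
      unfolding fillers_def f_def
      by (intro CollectI conjI exI[of _ lo] exI[of _ "lo + 2"] exI[of _ 2] exI[of _ "s - 2"])
         (use assms in \<open>auto simp: card_osc\<close>)
    then show ?thesis by simp
  qed
  then have "card {f 0, f 1} \<le> card (fillers s (Suc s))" by (intro card_mono finite_fillers)
  finally show ?thesis .
qed

lemma card_fillers:
  assumes "4 \<le> s" "s + 2 \<le> n"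
  shows "2 * (s - 3) \<le> card (fillers s n)"
proof -
  \<comment> \<open>The span \<open>n + 1 - s\<close> leaves \<open>n - s\<close> interior columns,
    for total length \<open>n\<close>; it is at least 3, so \<open>operm_osc_inject\<close> recovers
    both parity and \<open>a\<close>.\<close>
  define f where "f = (\<lambda>(lo::int, a). operm (osc lo (lo + int (n + 1 - s)) a (s - a)))"
  let ?A = "{0::int, 1} \<times> {2..s - 2}"
  have inj: "inj_on f ?A"
  proof (rule inj_onI)
    fix u v assume uv: "u \<in> ?A" "v \<in> ?A" "f u = f v"
    obtain lo a lo' a' where e: "u = (lo, a)" "v = (lo', a')" by (cases u; cases v)
    have "Suc 0 \<le> s - a" "Suc 0 \<le> s - a'" using uv(1,2) assms unfolding e by auto
    then have "even lo = even lo' \<and> a = a'"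
      using operm_osc_inject[OF uv(3)[unfolded f_def e prod.case]] uv(1,2) assms unfolding e
      by (auto simp: of_nat_diff)
    then show "u = v" using uv(1,2) unfolding e by auto
  qed
  have "2 * (s - 3) = card ?A" using assms by (simp add: card_cartesian_product)
  also have "\<dots> = card (f ` ?A)" by (simp add: card_image[OF inj])
  also have "\<dots> \<le> card (fillers s n)"
  proof (intro card_mono finite_fillers image_subsetI)
    fix u assume u: "u \<in> ?A"
    obtain lo a where e: "u = (lo, a)" by (cases u)
    show "f u \<in> fillers s n"
      unfolding fillers_def f_def e prod.case
      by (intro CollectI conjI exI[of _ lo] exI[of _ "lo + int (n + 1 - s)"] exI[of _ a] exI[of _ "s - a"])
         (use assms u e in \<open>auto simp: card_osc\<close>)
  qed
  finally show ?thesis .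
qed

text \<open>The pairs form a triangle. The factor 2 avoids a division and will account for the two
  parities of \<open>lo\<close>.\<close>

lemma card_compositions_less: "2 * card {(a, b). 1 \<le> a \<and> 1 \<le> b \<and> a + b < (s::nat)} = (s - 1) * (s - 2)"
proof (induction s)
  case (Suc s)
  let ?P = "\<lambda>s. {(a, b). 1 \<le> a \<and> 1 \<le> b \<and> a + b < (s::nat)}"
  have fin: "finite (?P s)" by (rule finite_subset[of _ "{..s} \<times> {..s}"]) auto
  note fin' = fin[simplified]
  have "?P (Suc s) = ?P s \<union> (\<lambda>a. (a, s - a)) ` {1..<s}" by (auto simp: image_iff less_Suc_eq)
  moreover have "card (?P s \<union> (\<lambda>a. (a, s - a)) ` {1..<s}) = card (?P s) + (s - 1)"
    by (subst card_Un_disjoint) (auto simp: fin' card_image inj_on_def)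
  ultimately have "2 * card (?P (Suc s)) = (s - 1) * (s - 2) + 2 * (s - 1)" using Suc by simp
  then show ?case by (cases s; cases "s - 1") (auto simp: algebra_simps)
qed simp

text \<open>The length determines \<open>hi\<close> from \<open>lo\<close>, \<open>a\<close>,
  \<open>b\<close>, and an even shift brings \<open>lo\<close> to 0 or 1. Distinct triples may give
  the same permutation, so this is an upper bound.\<close>

lemma card_osc_base:
  assumes "2 \<le> n"
  shows "card (of_length (osc_base s) n) \<le> (s - 1) * (s - 2)"
proof -
  let ?P = "{(a, b). 1 \<le> a \<and> 1 \<le> b \<and> a + b < s}"
  have fin: "finite ?P" by (rule finite_subset[of _ "{..s} \<times> {..s}"]) auto
  define f where "f = (\<lambda>(lo::int, a, b). operm (osc lo (lo + int n + 1 - int (a + b)) a b))"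
  have "of_length (osc_base s) n \<subseteq> f ` ({0, 1} \<times> ?P)"
  proof
    fix \<tau> assume "\<tau> \<in> of_length (osc_base s) n"
    then have "\<tau> \<in> osc_base s" "length \<tau> = n" "\<tau> \<noteq> [1]" using assms by (auto simp: of_length_def)
    then obtain lo hi a b where o: "lo < hi" "1 \<le> a" "1 \<le> b" "a + b < s" "\<tau> = operm (osc lo hi a b)"
      by (auto simp: osc_base_def)
    have hi: "hi = lo + int n + 1 - int (a + b)"
      using \<open>length \<tau> = n\<close> o card_osc[OF o(1), of a b] by simp
    have "\<tau> = operm (osc (lo mod 2) (hi - 2 * (lo div 2)) a b)"
      using operm_shift[of "lo mod 2" "lo div 2" "hi - 2 * (lo div 2)" a b] o(5) by simp
    also have "\<dots> = f (lo mod 2, a, b)"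
      by (simp add: f_def hi minus_div_mult_eq_mod[symmetric] algebra_simps)
    finally show "\<tau> \<in> f ` ({0, 1} \<times> ?P)" using o by (intro image_eqI[of _ _ "(lo mod 2, a, b)"]) auto
  qed
  then have "card (of_length (osc_base s) n) \<le> card (f ` ({0, 1} \<times> ?P))"
    by (intro card_mono finite_imageI finite_cartesian_product fin) auto
  also have "\<dots> \<le> card ({0::int, 1} \<times> ?P)" by (intro card_image_le finite_cartesian_product fin) auto
  also have "\<dots> = (s - 1) * (s - 2)" using card_compositions_less[of s] by (simp add: card_cartesian_product)
  finally show ?thesis .
qed

text \<open>A 321 pattern is a triangle in the inversion graph, but three integers cannot be
  pairwise at distance 1.\<close>

lemma osc_no_321:
  assumes "i < j" "j < k" "k < card (osc lo hi a b)"
  shows "\<not> (operm (osc lo hi a b) ! i > operm (osc lo hi a b) ! j \<and> operm (osc lo hi a b) ! j > operm (osc lo hi a b) ! k)"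
proof
  let ?P = "osc lo hi a b"
  assume d: "operm ?P ! i > operm ?P ! j \<and> operm ?P ! j > operm ?P ! k"
  have lt: "i < card ?P" "j < card ?P" using assms by auto
  obtain p where p: "p \<in> ?P" "i = rank hpos ?P p" by (rule rank_surj[OF finite_osc inj_hpos lt(1)])
  obtain q where q: "q \<in> ?P" "j = rank hpos ?P q" by (rule rank_surj[OF finite_osc inj_hpos lt(2)])
  obtain r where r: "r \<in> ?P" "k = rank hpos ?P r" by (rule rank_surj[OF finite_osc inj_hpos assms(3)])
  have "hpos p < hpos q" "hpos q < hpos r" "vpos q < vpos p" "vpos r < vpos q"
    using assms d p q r by (simp_all add: nth_perm_of rank_less_iff finite_osc inj_hpos)
  then have "(hpos p < hpos q) \<noteq> (vpos p < vpos q)" "(hpos q < hpos r) \<noteq> (vpos q < vpos r)"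
    "(hpos p < hpos r) \<noteq> (vpos p < vpos r)" by auto
  then have "\<bar>fst p - fst q\<bar> = 1" "\<bar>fst q - fst r\<bar> = 1" "\<bar>fst p - fst r\<bar> = 1"
    by (simp_all only: inverted_iff)
  then show False by presburger
qed

section \<open>Counting indecomposables\<close>

abbreviation ind_count :: "nat \<Rightarrow> nat" where
  "ind_count n \<equiv> card (of_length {\<tau>. indecomposable \<tau>} n)"

lemma finite_of_length_indecomposable:
  "I \<subseteq> {\<tau>. indecomposable \<tau>} \<Longrightarrow> finite (of_length I n)"
  by (rule finite_of_length) (auto simp: indecomposable_def)

lemma ind_count_0: "ind_count 0 = 0"
  by (auto simp: of_length_def indecomposable_def)

lemma ind_count_le_fact: "ind_count n \<le> fact n"
  unfolding card_permutations[symmetric]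
  by (intro card_mono finite_permutations) (auto simp: of_length_def indecomposable_def)

lemma indecomposable_max_first:
  assumes "is_permutation \<pi>"
  shows "indecomposable (Suc (length \<pi>) # \<pi>)"
proof -
  have \<pi>: "distinct \<pi>" "set \<pi> = {1..length \<pi>}" using assms by (auto simp: is_permutation_iff)
  have "is_permutation (Suc (length \<pi>) # \<pi>)"
    by (rule is_permutationI) (use \<pi> in auto)
  moreover have "\<pi> ! (k - 1) \<le> Suc (length \<pi>)" if "0 < k" "k < Suc (length \<pi>)" for k
    using nth_permutation_bounds[OF assms, of "k - 1"] that by (cases k) auto
  ultimately have "\<exists>i<k. \<exists>j. k \<le> j \<and> j < length (Suc (length \<pi>) # \<pi>) \<and>
      (Suc (length \<pi>) # \<pi>) ! j \<le> (Suc (length \<pi>) # \<pi>) ! i"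
    if "0 < k" "k < length (Suc (length \<pi>) # \<pi>)" for k
    using that by (intro exI[of _ 0] conjI exI[of _ k]) auto
  then show ?thesis using \<open>is_permutation (Suc (length \<pi>) # \<pi>)\<close> by (simp add: indecomposable_def)
qed

text \<open>A leading maximum makes any permutation indecomposable. The factorial growth ensures
  that the weight of all indecomposables eventually exceeds 1, whatever the growth rate.\<close>

lemma ind_count_ge_fact: "fact n \<le> ind_count (Suc n)"
proof -
  have "fact n = card ((#) (Suc n) ` {\<pi>. is_permutation \<pi> \<and> length \<pi> = n})"
    by (simp add: card_image card_permutations)
  also have "\<dots> \<le> ind_count (Suc n)"
    by (intro card_mono finite_of_length_indecomposable)
       (auto simp: of_length_def indecomposable_max_first)
  finally show ?thesis .
qed

lemma indecomposableD:
  assumes "indecomposable \<tau>" "0 < k" "k < length \<tau>"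
  shows "\<exists>i<k. \<exists>j\<in>{k..<length \<tau>}. \<tau> ! j < \<tau> ! i"
proof -
  obtain i j where ij: "i < k" "k \<le> j" "j < length \<tau>" "\<tau> ! j \<le> \<tau> ! i"
    using assms unfolding indecomposable_def by blast
  have "\<tau> ! j \<noteq> \<tau> ! i"
    using ij assms by (auto simp: indecomposable_def is_permutation_iff nth_eq_iff_index_eq)
  then show ?thesis using ij by (intro exI[of _ i] conjI bexI[of _ j]) auto
qed

lemma ind_count_2: "ind_count 2 \<le> 1"
proof -
  have "of_length {\<tau>. indecomposable \<tau>} 2 \<subseteq> {[2, 1]}"
  proof
    fix \<tau> assume "\<tau> \<in> of_length {\<tau>. indecomposable \<tau>} 2"
    then have \<tau>: "indecomposable \<tau>" "length \<tau> = 2" by (auto simp: of_length_def)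
    then obtain x z where e: "\<tau> = [x, z]" by (auto simp: length_Suc_conv numeral_2_eq_2)
    have "x \<in> {1,2}" "z \<in> {1,2}"
      using nth_permutation_bounds[of \<tau> 0] nth_permutation_bounds[of \<tau> 1] \<tau>
      unfolding indecomposable_def e by auto
    then show "\<tau> \<in> {[2, 1]}" using indecomposableD[OF \<tau>(1), of 1] unfolding e by auto
  qed
  then have "ind_count 2 \<le> card {[2, 1::nat]}" by (intro card_mono) auto
  then show ?thesis by simp
qed

lemma ind_count_3: "ind_count 3 \<le> 3"
proof -
  let ?S = "{[2, 3, 1], [3, 1, 2], [3, 2, 1]} :: nat list set"
  have "of_length {\<tau>. indecomposable \<tau>} 3 \<subseteq> ?S"
  proof
    fix \<tau> assume "\<tau> \<in> of_length {\<tau>. indecomposable \<tau>} 3"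
    then have \<tau>: "indecomposable \<tau>" "length \<tau> = 3" by (auto simp: of_length_def)
    then obtain x z w where e: "\<tau> = [x, z, w]" by (auto simp: length_Suc_conv numeral_3_eq_3)
    have "x \<in> {1,2,3}" "z \<in> {1,2,3}" "w \<in> {1,2,3}"
      using nth_permutation_bounds[of \<tau> 0] nth_permutation_bounds[of \<tau> 1] nth_permutation_bounds[of \<tau> 2] \<tau>
      unfolding indecomposable_def e by auto
    moreover have "z < x \<or> w < x" using indecomposableD[OF \<tau>(1), of 1] unfolding e
      by (auto simp: nth_Cons' split: if_splits)
    moreover have "w < x \<or> w < z" using indecomposableD[OF \<tau>(1), of 2] unfolding e
      by (auto simp: nth_Cons' less_2_cases_iff split: if_splits)
    moreover have "distinct \<tau>" using \<tau> by (simp add: indecomposable_def is_permutation_iff)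
    ultimately show "\<tau> \<in> ?S" unfolding e by auto
  qed
  then have "ind_count 3 \<le> card ?S" by (intro card_mono) auto
  also have "card ?S \<le> 3" by (simp add: card_insert_if)
  finally show ?thesis .
qed

text \<open>The list consists of the indecomposable 321-avoiders. For \<open>s = 4\<close> this
  improves the general bound 6 of \<open>card_osc_base\<close> to the 5 that leads to the
  quintic.\<close>

lemma osc_base_4: "card (of_length (osc_base s) 4) \<le> 5"
proof -
  let ?S = "{[2, 3, 4, 1], [2, 4, 1, 3], [3, 1, 4, 2], [3, 4, 1, 2], [4, 1, 2, 3]} :: nat list set"
  have "of_length (osc_base s) 4 \<subseteq> ?S"
  proof
    fix \<tau> assume "\<tau> \<in> of_length (osc_base s) 4"
    then have \<tau>: "indecomposable \<tau>" "length \<tau> = 4" and base: "\<tau> \<in> osc_base s"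
      by (auto simp: of_length_def osc_base_def)
    have no: "\<not> (\<tau> ! j < \<tau> ! i \<and> \<tau> ! k < \<tau> ! j)" if "i < j" "j < k" "k < 4" for i j k
      using base \<tau>(2) osc_no_321[OF that(1,2)] that(3) by (auto simp: osc_base_def)
    obtain x z w v where e: "\<tau> = [x, z, w, v]"
      using \<tau>(2) by (auto simp: length_Suc_conv eval_nat_numeral)
    have "x \<in> {1,2,3,4}" "z \<in> {1,2,3,4}" "w \<in> {1,2,3,4}" "v \<in> {1,2,3,4}"
      using nth_permutation_bounds[of \<tau> 0] nth_permutation_bounds[of \<tau> 1]
        nth_permutation_bounds[of \<tau> 2] nth_permutation_bounds[of \<tau> 3] \<tau>
      unfolding indecomposable_def e by auto
    moreover have "z < x \<or> w < x \<or> v < x" using indecomposableD[OF \<tau>(1), of 1] unfolding e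
      by (auto simp: nth_Cons' split: if_splits)
    moreover have "v < x \<or> v < z \<or> v < w" using indecomposableD[OF \<tau>(1), of 3] unfolding e
      by (auto simp: nth_Cons' split: if_splits)
    moreover have "w < x \<or> w < z \<or> v < x \<or> v < z" using indecomposableD[OF \<tau>(1), of 2] unfolding e
      by (auto simp: nth_Cons' split: if_splits)
    moreover have "\<not> (z < x \<and> w < z)" "\<not> (z < x \<and> v < z)" "\<not> (w < x \<and> v < w)" "\<not> (w < z \<and> v < w)"
      using no[of 0 1 2] no[of 0 1 3] no[of 0 2 3] no[of 1 2 3] unfolding e by auto
    moreover have "distinct \<tau>" using \<tau> by (simp add: indecomposable_def is_permutation_iff)
    ultimately show "\<tau> \<in> ?S" unfolding e by - (elim insertE emptyE; simp)
  qed
  then have "card (of_length (osc_base s) 4) \<le> card ?S" by (intro card_mono) auto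
  also have "card ?S \<le> 5" by (simp add: card_insert_if)
  finally show ?thesis .
qed

lemma contains_same_length:
  assumes "contains \<pi> \<sigma>" "length \<pi> = length \<sigma>" "is_permutation \<pi>" "is_permutation \<sigma>"
  shows "\<pi> = \<sigma>"
proof (rule nth_equalityI[OF assms(2)])
  obtain xs where xs: "subseq xs \<pi>" "same_relative_order xs \<sigma>" using assms by (auto simp: contains_def)
  then have "xs = \<pi>" using assms(2) by (simp add: same_relative_order_def subseq_same_length)
  then have ord: "\<pi> ! i < \<pi> ! j \<longleftrightarrow> \<sigma> ! i < \<sigma> ! j" if "i < length \<pi>" "j < length \<pi>" for i j
    using xs(2) that by (auto simp: same_relative_order_def)
  fix i assume i: "i < length \<pi>"
  have "{j. j < length \<pi> \<and> \<pi> ! j < \<pi> ! i} = {j. j < length \<sigma> \<and> \<sigma> ! j < \<sigma> ! i}"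
    using ord i assms(2) by auto
  then show "\<pi> ! i = \<sigma> ! i"
    using nth_permutation[OF assms(3) i] nth_permutation[OF assms(4), of i] i assms(2) by simp
qed

section \<open>Attaining a prescribed growth rate\<close>

abbreviation base_count :: "nat \<Rightarrow> nat \<Rightarrow> nat" where
  "base_count s n \<equiv> card (of_length (osc_base s) n)"

text \<open>
  For \<open>n \<ge> s + 1\<close>, \<open>filler_tail s y n\<close> is the closed form of the total weight \<open>\<Sum>y\<^sup>m\<close> of fillers of length
  \<open>m \<ge> n\<close>, two of them used at length \<open>s + 1\<close>, where they come from a path on three points, whose
  permutation depends only on \<open>a + b\<close>.
\<close>

definition filler_tail :: "nat \<Rightarrow> real \<Rightarrow> nat \<Rightarrow> real" where
  "filler_tail s y n = (if n \<le> s + 1 then 2 * y ^ (s + 1) + 2 * (real s - 3) * y ^ (s + 2) / (1 - y)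
     else 2 * (real s - 3) * y ^ n / (1 - y))"

text \<open>The numbers guaranteed by \<open>card_fillers_stars\<close> and
  \<open>card_fillers\<close>; below length \<open>s + 1\<close> the value is a dummy.\<close>

definition filler_count :: "nat \<Rightarrow> nat \<Rightarrow> nat" where
  "filler_count s n = (if n \<le> s + 1 then 2 else 2 * (s - 3))"

lemma filler_tail_rec:
  assumes "4 \<le> s" "s + 1 \<le> n" "y < 1"
  shows "filler_tail s y n = real (filler_count s n) * y ^ n + filler_tail s y (Suc n)"
proof (cases "n = s + 1")
  case True
  then show ?thesis by (simp add: filler_tail_def filler_count_def)
next
  case False
  then show ?thesis using assms
    by (simp add: filler_tail_def filler_count_def of_nat_diff field_simps)
qed

lemma filler_count_le:
  assumes "4 \<le> s" "s + 1 \<le> n"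
  shows "filler_count s n \<le> card (fillers s n)"
  using assms card_fillers_stars[of s] card_fillers[of s n] by (cases "n = s + 1") (auto simp: filler_count_def)

lemma base_count_le_ind_count: "base_count s n \<le> ind_count n"
  by (intro card_mono finite_of_length_indecomposable) (auto simp: of_length_def osc_base_def)

text \<open>All indecomposables shorter than \<open>k\<close> are in, so the extras of length
  \<open>k\<close> can be arbitrary. Longer extras are fillers, whose proper indecomposable patterns
  lie in the base. Hence every choice of extras is downward closed.\<close>

lemma realize_counts:
  fixes x :: "nat \<Rightarrow> nat"
  assumes s: "4 \<le> s" and k: "s \<le> k" and x0: "\<And>n. n < k \<Longrightarrow> x n = 0"
    and xk: "x k \<le> ind_count k - base_count s k" and x: "\<And>n. k < n \<Longrightarrow> x n \<le> filler_count s n"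
  obtains I where "\<forall>\<alpha>\<in>I. indecomposable \<alpha>"
    "\<And>\<alpha> \<tau>. \<alpha> \<in> I \<Longrightarrow> indecomposable \<tau> \<Longrightarrow> contains \<alpha> \<tau> \<Longrightarrow> \<tau> \<in> I"
    "\<And>n. card (of_length I n) = (if n < k then ind_count n else base_count s n) + x n" "[1] \<in> I"
proof -
  let ?E = "\<lambda>n. if n < k then {} else if n = k then of_length {\<tau>. indecomposable \<tau>} k - of_length (osc_base s) k
    else fillers s n"
  have fb: "finite (of_length (osc_base s) n)" for n
    by (intro finite_of_length_indecomposable) (auto simp: osc_base_def)
  have "x n \<le> card (?E n)" for n
  proof -
    have "card (of_length {\<tau>. indecomposable \<tau>} k - of_length (osc_base s) k) = ind_count k - base_count s k"
      by (rule card_Diff_subset[OF fb]) (auto simp: of_length_def osc_base_def)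
    then show ?thesis using x0 xk x[of n] filler_count_le[OF s, of n] k by (cases n k rule: linorder_cases) auto
  qed
  then have "\<exists>X. X \<subseteq> ?E n \<and> card X = x n \<and> finite X" for n
    by (meson obtain_subset_with_card_n)
  then obtain X where X: "X n \<subseteq> ?E n" "card (X n) = x n" "finite (X n)" for n by metis
  define I where "I = {\<tau>. indecomposable \<tau> \<and> (length \<tau> < k \<or> \<tau> \<in> osc_base s \<or> \<tau> \<in> X (length \<tau>))}"
  have XI: "indecomposable \<tau> \<and> length \<tau> = n \<and> \<tau> \<notin> osc_base s" if "\<tau> \<in> X n" for \<tau> n
  proof -
    have "\<tau> \<in> ?E n" using X(1) that by blast
    then consider "\<tau> \<in> of_length {\<tau>. indecomposable \<tau>} n - of_length (osc_base s) n" | "\<tau> \<in> fillers s n"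
      by (auto split: if_splits)
    then show ?thesis
    proof cases
      case 2
      moreover from this have "length \<tau> = n" by (simp add: fillers_def)
      ultimately show ?thesis using indecomposable_fillers fillers_disjoint[OF s, of n] by blast
    qed (auto simp: of_length_def)
  qed
  have bi: "indecomposable \<tau>" if "\<tau> \<in> osc_base s" for \<tau> using that by (simp add: osc_base_def)
  show thesis
  proof (rule that)
    show "\<forall>\<alpha>\<in>I. indecomposable \<alpha>" by (simp add: I_def)
    show "\<tau> \<in> I" if a: "\<alpha> \<in> I" "indecomposable \<tau>" "contains \<alpha> \<tau>" for \<alpha> \<tau>
    proof (cases "length \<tau> < k \<or> \<tau> = \<alpha>")
      case True
      then show ?thesis using a by (auto simp: I_def)
    next
      case False
      have len: "length \<tau> \<le> length \<alpha>" by (rule contains_length_le[OF a(3)])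
      have "length \<tau> \<noteq> length \<alpha>"
        using contains_same_length[OF a(3)] False a by (auto simp: I_def indecomposable_def)
      then have "k < length \<alpha>" using False len by simp
      then consider "\<alpha> \<in> osc_base s" | "\<alpha> \<in> fillers s (length \<alpha>)"
        using a(1) X(1)[of "length \<alpha>"] by (auto simp: I_def)
      then have "\<tau> \<in> osc_base s"
        using osc_base_closed[OF _ a(2,3)] fillers_closed[OF _ a(2,3)] False by cases auto
      then show ?thesis using a(2) by (simp add: I_def)
    qed
    show "card (of_length I n) = (if n < k then ind_count n else base_count s n) + x n" for n
    proof (cases "n < k")
      case True
      then have "of_length I n = of_length {\<tau>. indecomposable \<tau>} n" by (auto simp: of_length_def I_def)
      then show ?thesis using True x0 by simp
    next
      case False
      then have "of_length I n = of_length (osc_base s) n \<union> X n"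
        using XI bi by (auto simp: of_length_def I_def)
      moreover have "of_length (osc_base s) n \<inter> X n = {}" using XI by (auto simp: of_length_def)
      ultimately show ?thesis using False by (simp add: card_Un_disjoint fb X)
    qed
    show "[1] \<in> I" using s k by (auto simp: I_def indecomposable_def is_permutation_iff)
  qed
qed

text \<open>\<open>base\<close> bounds the weight of the base plus all indecomposables shorter than
  \<open>k0\<close> by 1, with \<open>e\<close> and \<open>(s - 1) * (s - 2)\<close> bounding the
  base from length \<open>k0\<close> on. \<open>fill1\<close> and \<open>fill2\<close> say that one
  item of length \<open>n\<close> never outweighs the fillers beyond it, which is what the greedy
  choice requires.\<close>

lemma attain_growth_rate:
  fixes g y :: real
  assumes s: "4 \<le> s" and k0: "s \<le> k0" and g: "1 < g" and y: "y = 1 / g"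
    and e: "base_count s k0 \<le> e"
    and base: "(\<Sum>n<k0. real (ind_count n) * y ^ n) + real e * y ^ k0
        + real ((s - 1) * (s - 2)) * y ^ Suc k0 / (1 - y) \<le> 1"
    and fill1: "k0 = s \<Longrightarrow> 1 \<le> 2 * y + 2 * (real s - 3) * y\<^sup>2 / (1 - y)"
    and fill2: "1 - y \<le> 2 * (real s - 3) * y"
  shows "\<exists>C. permutation_class C \<and> has_growth_rate C g"
proof -
  have y01: "0 < y" "y < 1" using g y by auto
  define dy where "dy = (\<lambda>n. real (base_count s n) * y ^ n)"
  \<comment> \<open>The weight gained by enlarging the base at length \<open>n\<close> to all
    indecomposables; \<open>A k\<close> below does this for all lengths less than
    \<open>k\<close>.\<close>
  define ey where "ey = (\<lambda>n. (real (ind_count n) - real (base_count s n)) * y ^ n)"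
  define M where "M = (s - 1) * (s - 2)"
  have dle: "base_count s n \<le> M" if "2 \<le> n" for n unfolding M_def by (rule card_osc_base[OF that])
  have ey0: "0 \<le> ey n" for n using base_count_le_ind_count y01 by (simp add: ey_def)
  have dy0: "0 \<le> dy n" for n using y01 by (simp add: dy_def)
  have sumd: "summable dy"
    by (rule summable_comparison_test'[of "\<lambda>n. M * y ^ n" 2])
       (use dle y01 in \<open>auto simp: dy_def intro!: summable_mult summable_geometric mult_right_mono\<close>)
  define A where "A = (\<lambda>k. suminf dy + (\<Sum>n<k. ey n))"
  have A0: "A k0 \<le> 1"
  proof -
    have "suminf dy = (\<Sum>n. dy (n + Suc k0)) + (\<Sum>n<Suc k0. dy n)"
      by (rule suminf_split_initial_segment[OF sumd])
    moreover have "(\<Sum>n. dy (n + Suc k0)) \<le> (\<Sum>n. real M * y ^ Suc k0 * y ^ n)"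
    proof (rule suminf_le)
      show "dy (n + Suc k0) \<le> real M * y ^ Suc k0 * y ^ n" for n
      proof -
        have "base_count s (n + Suc k0) \<le> M" using s k0 by (intro dle) simp
        then have "dy (n + Suc k0) \<le> real M * y ^ (n + Suc k0)"
          unfolding dy_def using y01 by (intro mult_right_mono) auto
        then show ?thesis by (simp add: power_add mult_ac)
      qed
      show "summable (\<lambda>n. dy (n + Suc k0))" by (rule summable_ignore_initial_segment[OF sumd])
      show "summable (\<lambda>n. real M * y ^ Suc k0 * y ^ n)"
        using y01 by (intro summable_mult summable_geometric) auto
    qed
    moreover have "(\<Sum>n. real M * y ^ Suc k0 * y ^ n) = real M * y ^ Suc k0 * (1 / (1 - y))"
      using y01 by (subst suminf_mult) (auto simp: suminf_geometric intro!: summable_geometric)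
    moreover have "dy k0 \<le> real e * y ^ k0"
      unfolding dy_def using e y01 by (intro mult_right_mono) auto
    moreover have "(\<Sum>n<k0. dy n) + (\<Sum>n<k0. ey n) = (\<Sum>n<k0. real (ind_count n) * y ^ n)"
      by (simp add: dy_def ey_def algebra_simps flip: sum.distrib)
    ultimately show ?thesis using base by (simp add: A_def M_def)
  qed
  have "\<exists>k. 1 < A k"
  proof -
    have "(\<lambda>n. g ^ n / fact n) \<longlonglongrightarrow> 0"
      using summable_LIMSEQ_zero[OF summable_exp[of g]] by (simp add: field_simps)
    then have "eventually (\<lambda>n. g ^ n / fact n < y) sequentially" using y01 by (simp add: order_tendstoD(2))
    then obtain n where n: "g ^ n / fact n < y" by (auto simp: eventually_sequentially)
    then have "1 < fact n * y ^ Suc n"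
      using g by (simp add: y field_simps)
    also have "\<dots> \<le> real (ind_count (Suc n)) * y ^ Suc n"
    proof (rule mult_right_mono)
      show "fact n \<le> real (ind_count (Suc n))"
        using of_nat_mono[OF ind_count_ge_fact[of n], where 'a = real] by simp
    qed (use y01 in simp)
    also have "\<dots> = dy (Suc n) + ey (Suc n)" by (simp add: dy_def ey_def algebra_simps)
    also have "\<dots> \<le> A (Suc (Suc n))"
    proof -
      have "dy (Suc n) \<le> suminf dy" using sum_le_suminf[OF sumd, of "{Suc n}"] dy0 by simp
      moreover have "ey (Suc n) \<le> (\<Sum>n<Suc (Suc n). ey n)"
        using member_le_sum[of "Suc n" "{..<Suc (Suc n)}" ey] ey0 by simp
      ultimately show ?thesis by (simp add: A_def)
    qed
    finally show ?thesis by blast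
  qed
  then obtain K where K: "1 < A K" "\<And>k. k < K \<Longrightarrow> A k \<le> 1"
    using exists_least_iff[of "\<lambda>k. 1 < A k"] by (auto simp: not_less)
  have mono: "A i \<le> A j" if "i \<le> j" for i j
    unfolding A_def using that ey0 by (simp, intro sum_mono2) auto
  have "k0 < K" using mono[of K k0] K(1) A0 by (cases "k0 < K") auto
  \<comment> \<open>The last cutoff whose weight is at most 1: taking all indecomposables of length
    \<open>k\<close> as well would exceed 1.\<close>
  define k where "k = K - 1"
  have "A K = A k + ey k" using \<open>k0 < K\<close> by (cases K) (simp_all add: k_def A_def)
  then have k: "k0 \<le> k" "A k \<le> 1" "1 < A k + ey k"
    using \<open>k0 < K\<close> K(1) K(2)[of k] by (simp_all add: k_def)
  \<comment> \<open>At length \<open>k\<close> the stock consists of the indecomposables outside the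
    base, above it of fillers; \<open>T n\<close> is the weight in stock from length
    \<open>n\<close> on.\<close>
  define F where "F = (\<lambda>n. if n = k then ind_count k - base_count s k else filler_count s n)"
  define T where "T = (\<lambda>n. if n = k then ey k + filler_tail s y (Suc k) else filler_tail s y n)"
  have tail0: "0 \<le> filler_tail s y n" for n using y01 s by (auto simp: filler_tail_def)
  obtain x :: "nat \<Rightarrow> nat" where x: "\<And>n. x n \<le> F n" "\<And>n. n < k \<Longrightarrow> x n = 0"
    "(\<lambda>n. real (x n) * y ^ n) sums (1 - A k)"
  proof (rule greedy_fill[of y k T F "1 - A k"])
    show "T n = real (F n) * y ^ n + T (Suc n)" if "k \<le> n" for n
    proof (cases "n = k")
      case True
      then show ?thesis using base_count_le_ind_count[of s k] by (simp add: T_def F_def ey_def of_nat_diff)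
    next
      case False
      then show ?thesis using filler_tail_rec[OF s, of n y] that k(1) k0 y01 by (simp add: T_def F_def)
    qed
    have "(\<lambda>n. 2 * (real s - 3) * y ^ n / (1 - y)) \<longlonglongrightarrow> 2 * (real s - 3) * 0 / (1 - y)"
      using y01 by (intro tendsto_intros LIMSEQ_realpow_zero) auto
    moreover have "eventually (\<lambda>n. 2 * (real s - 3) * y ^ n / (1 - y) = T n) sequentially"
      by (rule eventually_sequentiallyI[of "k + s + 2"]) (auto simp: T_def filler_tail_def)
    ultimately show "T \<longlonglongrightarrow> 0" by (simp add: tendsto_cong)
    show "y ^ n \<le> T (Suc n)" if n: "k \<le> n" for n
    \<comment> \<open>This happens only for \<open>k = k0 = s\<close>. The next length
      \<open>s + 1\<close> offers just two fillers, so it has its own condition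
      \<open>fill1\<close>.\<close>
    proof (cases "n = s")
      case True
      then have "k0 = s" using n k(1) k0 by simp
      from mult_left_mono[OF fill1[OF this], of "y ^ s"] y01 True n k(1) k0
      show ?thesis by (simp add: T_def filler_tail_def algebra_simps power2_eq_square)
    next
      case False
      then have "s < n" using n k(1) k0 by simp
      have "1 \<le> 2 * (real s - 3) * y / (1 - y)" using fill2 y01 by (simp add: pos_le_divide_eq)
      from mult_left_mono[OF this, of "y ^ n"] y01
      have "y ^ n \<le> 2 * (real s - 3) * y ^ Suc n / (1 - y)" by (simp add: mult_ac)
      then show ?thesis using n \<open>s < n\<close> by (simp add: T_def filler_tail_def)
    qed
    show "1 - A k \<le> T k" using k(3) tail0[of "Suc k"] by (simp add: T_def)
  qed (use y01 k(2) in auto)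
  have sk: "s \<le> k" using k0 k(1) by simp
  have xk: "x k \<le> ind_count k - base_count s k" using x(1)[of k] by (simp add: F_def)
  have xl: "x n \<le> filler_count s n" if "k < n" for n using x(1)[of n] that by (simp add: F_def)
  obtain I where I: "\<forall>\<alpha>\<in>I. indecomposable \<alpha>"
    "\<And>\<alpha> \<tau>. \<alpha> \<in> I \<Longrightarrow> indecomposable \<tau> \<Longrightarrow> contains \<alpha> \<tau> \<Longrightarrow> \<tau> \<in> I"
    "\<And>n. card (of_length I n) = (if n < k then ind_count n else base_count s n) + x n" "[1] \<in> I"
    using realize_counts[OF s sk x(2) xk xl] by blast
  have "has_growth_rate (sum_class I) g"
  proof (rule sum_class_growth_rate[OF _ I(1,4) g])
    show "\<tau> \<in> I" if "\<alpha> \<in> I" "indecomposable \<tau>" "contains \<alpha> \<tau>" for \<alpha> \<tau> using I(2)[OF that] .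
    have "(\<lambda>n. if n < k then ey n else 0) sums (\<Sum>n<k. ey n)"
      using sums_If_finite[of "\<lambda>n. n < k" ey] by (simp add: lessThan_def)
    from sums_add[OF sums_add[OF summable_sums[OF sumd] this] x(3)]
    have "(\<lambda>n. dy n + (if n < k then ey n else 0) + real (x n) * y ^ n) sums 1" by (simp add: A_def)
    moreover have "dy n + (if n < k then ey n else 0) + real (x n) * y ^ n = real (card (of_length I n)) * y ^ n" for n
      by (simp add: I(3) dy_def ey_def algebra_simps)
    ultimately show "(\<lambda>n. real (card (of_length I n)) * (1 / g) ^ n) sums 1" by (simp add: y)
    show "card (of_length I n) \<le> fact k + M + 2 + 2 * (s - 3)" for n
    proof (cases n k rule: linorder_cases)
      case less
      then have "ind_count n \<le> fact k" using ind_count_le_fact[of n] fact_mono[of n k] by (meson less_imp_le order_trans)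
      then show ?thesis using less x(2) by (simp add: I(3))
    next
      case equal
      then show ?thesis using x(1)[of k] ind_count_le_fact[of k] base_count_le_ind_count[of s k]
        by (simp add: I(3) F_def)
    next
      case greater
      then show ?thesis using x(1)[of n] dle[of n] s k0 k(1) by (simp add: I(3) F_def filler_count_def split: if_splits)
    qed
  qed
  then show ?thesis using permutation_class_sum_class by blast
qed

section \<open>Numerical estimates\<close>

text \<open>In terms of \<open>1 / x\<close> the sign is governed by a polynomial with nonnegative
  coefficients, hence monotone; this yields uniqueness of the root and the inequality needed above
  \<open>lam\<close>.\<close>

lemma quintic_reciprocal:
  assumes "x > 0"
  shows "quintic x = x ^ 5 * (1 - (2 * (1 / x) + 2 * (1 / x) ^ 3 + 2 * (1 / x) ^ 4 + (1 / x) ^ 5))"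
  using assms by (simp add: quintic_def field_simps eval_nat_numeral)

lemma quintic_neg: "x \<le> 2 \<Longrightarrow> quintic x < 0"
proof -
  assume "x \<le> 2"
  then have "x ^ 4 * (x - 2) \<le> 0" by (simp add: mult_nonneg_nonpos)
  moreover have "2 * x\<^sup>2 + 2 * x + 1 = (x + 1)\<^sup>2 + x\<^sup>2" by (simp add: power2_eq_square algebra_simps)
  moreover have "(x + 1)\<^sup>2 + x\<^sup>2 > 0" by (simp add: sum_power2_gt_zero_iff)
  moreover have "quintic x = x ^ 4 * (x - 2) - (2 * x\<^sup>2 + 2 * x + 1)"
    by (simp add: quintic_def eval_nat_numeral algebra_simps)
  ultimately show ?thesis by linarith
qed

lemma quintic_pos_mono:
  assumes "0 \<le> quintic x" "x < z"
  shows "0 < quintic z"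
proof -
  have x: "2 < x" using quintic_neg[of x] assms by (cases "x \<le> 2") auto
  define h :: "real \<Rightarrow> real" where "h = (\<lambda>y. 2 * y + 2 * y ^ 3 + 2 * y ^ 4 + y ^ 5)"
  have "1 / z < 1 / x" using assms(2) x by (intro divide_strict_left_mono) auto
  then have "h (1 / z) < h (1 / x)"
    unfolding h_def using x assms(2) by (intro add_strict_mono mult_strict_left_mono power_strict_mono) auto
  moreover have "h (1 / x) \<le> 1"
    using assms(1) x quintic_reciprocal[of x] by (simp add: h_def zero_le_mult_iff)
  ultimately show ?thesis using quintic_reciprocal[of z] x assms(2) by (simp add: h_def)
qed

lemma quintic_ex1: "\<exists>!x. quintic x = 0"
proof -
  have "\<exists>x\<ge>2. x \<le> 3 \<and> quintic x = 0"
    by (rule IVT') (auto simp: quintic_def intro!: continuous_intros)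
  then obtain x where "quintic x = 0" by blast
  then show ?thesis
    using quintic_pos_mono by (metis less_irrefl linorder_neqE order_refl)
qed

lemma quintic_pos: "lam < \<gamma> \<Longrightarrow> 0 < quintic \<gamma>"
  using quintic_pos_mono[of lam \<gamma>] theI'[OF quintic_ex1] by (simp add: lam_def)

section \<open>Choice of parameters in the ranges of growth rates\<close>

text \<open>Uses \<open>s = k0 = 4\<close> and the dominating counts
  \<open>1, 1, 3, 5, 6, 6, ...\<close>. The restriction \<open>\<gamma> \<le> 3\<close> is
  \<open>fill2\<close> for \<open>s = 4\<close>.\<close>

lemma growth_rate_near_lam:
  assumes "lam < \<gamma>" "\<gamma> \<le> 3"
  shows "\<exists>C. permutation_class C \<and> has_growth_rate C \<gamma>"
proof -
  define y where "y = 1 / \<gamma>"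
  have g: "2 < \<gamma>" using quintic_pos[OF assms(1)] quintic_neg[of \<gamma>] by (cases "\<gamma> \<le> 2") auto
  have y: "1 / 3 \<le> y" "y < 1 / 2" using assms(2) g by (auto simp: y_def field_simps)
  have h: "2 * y + 2 * y ^ 3 + 2 * y ^ 4 + y ^ 5 < 1"
    using quintic_pos[OF assms(1)] quintic_reciprocal[of \<gamma>] g by (simp add: y_def zero_less_mult_iff)
  show ?thesis
  proof (rule attain_growth_rate[of 4 4 \<gamma> y 5])
    have "(\<Sum>n<4. real (ind_count n) * y ^ n) \<le> y + y\<^sup>2 + 3 * y ^ 3"
    proof -
      have "(\<Sum>n<4. real (ind_count n) * y ^ n) = real (ind_count 1) * y + real (ind_count 2) * y\<^sup>2 + real (ind_count 3) * y ^ 3"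
        using ind_count_0 by (simp add: eval_nat_numeral)
      also have "\<dots> \<le> 1 * y + 1 * y\<^sup>2 + 3 * y ^ 3"
        using y ind_count_le_fact[of 1] ind_count_2 ind_count_3
        by (intro add_mono mult_right_mono) auto
      finally show ?thesis by simp
    qed
    moreover have "y + y\<^sup>2 + 3 * y ^ 3 + 5 * y ^ 4 + 6 * y ^ 5 / (1 - y) \<le> 1"
    proof -
      \<comment> \<open>Multiplying by \<open>1 - y\<close> telescopes the counts to their
        differences, and the required bound by \<open>1 - y\<close> becomes
        \<open>h\<close>.\<close>
      have "(y + y\<^sup>2 + 3 * y ^ 3 + 5 * y ^ 4) * (1 - y) + 6 * y ^ 5 = y + 2 * y ^ 3 + 2 * y ^ 4 + y ^ 5"
        by (simp add: eval_nat_numeral algebra_simps)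
      then have "6 * y ^ 5 \<le> (1 - (y + y\<^sup>2 + 3 * y ^ 3 + 5 * y ^ 4)) * (1 - y)"
        using h by (simp add: algebra_simps)
      then have "6 * y ^ 5 / (1 - y) \<le> 1 - (y + y\<^sup>2 + 3 * y ^ 3 + 5 * y ^ 4)"
        using y by (simp add: pos_divide_le_eq)
      then show ?thesis by simp
    qed
    ultimately show "(\<Sum>n<4. real (ind_count n) * y ^ n) + real 5 * y ^ 4
        + real ((4 - 1) * (4 - 2)) * y ^ Suc 4 / (1 - y) \<le> 1" by simp
    show "1 \<le> 2 * y + 2 * (real 4 - 3) * y\<^sup>2 / (1 - y)"
      using y by (simp add: field_simps power2_eq_square)
    show "1 - y \<le> 2 * (real 4 - 3) * y" using y by simp
  qed (use g in \<open>auto simp: y_def osc_base_4\<close>)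
qed

text \<open>Uses \<open>s = k0 = 5\<close> with \<open>e = 12\<close>, the bound of
  \<open>card_osc_base\<close>. For \<open>s = 5\<close> condition \<open>fill1\<close> holds up to
  about 3.56, so 7/2 is a safe end of the range.\<close>

lemma growth_rate_3:
  assumes "3 < \<gamma>" "\<gamma> \<le> 7 / 2"
  shows "\<exists>C. permutation_class C \<and> has_growth_rate C \<gamma>"
proof -
  define y where "y = 1 / \<gamma>"
  have y: "2 / 7 \<le> y" "y < 1 / 3" using assms by (auto simp: y_def field_simps)
  have pw: "y ^ n \<le> (1 / 3) ^ n" for n using y by (intro power_mono) auto
  show ?thesis
  proof (rule attain_growth_rate[of 5 5 \<gamma> y 12])
    have "(\<Sum>n<5. real (ind_count n) * y ^ n) = real (ind_count 1) * y ^ 1 + real (ind_count 2) * y\<^sup>2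
        + real (ind_count 3) * y ^ 3 + real (ind_count 4) * y ^ 4"
      using ind_count_0 by (simp add: eval_nat_numeral)
    also have "\<dots> \<le> 1 * (1/3) ^ 1 + 1 * (1/3)\<^sup>2 + 3 * (1/3) ^ 3 + 24 * (1/3) ^ 4"
      using y ind_count_le_fact[of 1] ind_count_2 ind_count_3 ind_count_le_fact[of 4]
      by (intro add_mono mult_mono pw) (auto simp: fact_numeral)
    finally have 1: "(\<Sum>n<5. real (ind_count n) * y ^ n) \<le> 23 / 27" by (simp add: eval_nat_numeral)
    have "12 * y ^ 6 / (1 - y) \<le> 12 * (1/3) ^ 6 / (2/3)"
      using y by (intro frac_le mult_left_mono pw) auto
    then show "(\<Sum>n<5. real (ind_count n) * y ^ n) + real 12 * y ^ 5
        + real ((5 - 1) * (5 - 2)) * y ^ Suc 5 / (1 - y) \<le> 1"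
      using 1 pw[of 5] by (simp add: eval_nat_numeral)
    have "(2/7)\<^sup>2 / (5/7) \<le> y\<^sup>2 / (1 - y)" using y by (intro frac_le power_mono) auto
    then show "1 \<le> 2 * y + 2 * (real 5 - 3) * y\<^sup>2 / (1 - y)"
      using y(1) by (simp add: power2_eq_square)
    show "1 - y \<le> 2 * (real 5 - 3) * y" using y by simp
    show "base_count 5 5 \<le> 12" using card_osc_base[of 5 5] by simp
  qed (use assms in \<open>auto simp: y_def\<close>)
qed

text \<open>Starting at \<open>k0 = Suc s\<close> makes \<open>fill1\<close> vacuous, and
  \<open>fill2\<close> becomes \<open>\<gamma> \<le> 2 * s - 5\<close>. With \<open>e\<close> equal
  to the general bound, the base from length \<open>Suc s\<close> on is majorized by a single
  geometric series.\<close>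

lemma growth_rate_large:
  assumes "7 / 2 < \<gamma>" "4 \<le> s" "\<gamma> + 5 \<le> 2 * real s"
    and base: "(\<Sum>n=1..s. real (ind_count n) * (1 / \<gamma>) ^ n) + real ((s - 1) * (s - 2)) * (1 / \<gamma>) ^ Suc s / (1 - 1 / \<gamma>) \<le> 1"
  shows "\<exists>C. permutation_class C \<and> has_growth_rate C \<gamma>"
proof -
  define y where "y = 1 / \<gamma>"
  have y: "0 < y" "y < 1" using assms by (auto simp: y_def)
  define M where "M = (s - 1) * (s - 2)"
  show ?thesis
  proof (rule attain_growth_rate[of s "Suc s" \<gamma> y M])
    have "(\<Sum>n<Suc s. real (ind_count n) * y ^ n) = (\<Sum>n=1..s. real (ind_count n) * y ^ n)"
      using ind_count_0 by (simp add: lessThan_Suc_atMost atMost_atLeast0 sum.atLeast_Suc_atMost)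
    moreover have "real M * y ^ Suc s + real M * y ^ Suc (Suc s) / (1 - y) = real M * y ^ Suc s / (1 - y)"
      using y by (simp add: field_simps)
    ultimately show "(\<Sum>n<Suc s. real (ind_count n) * y ^ n) + real M * y ^ Suc s
        + real ((s - 1) * (s - 2)) * y ^ Suc (Suc s) / (1 - y) \<le> 1"
      using base unfolding M_def y_def by linarith
    have "(\<gamma> - 1) * y \<le> 2 * (real s - 3) * y" using assms(3) y by (intro mult_right_mono) auto
    moreover have "\<gamma> * y = 1" using assms(1) by (simp add: y_def)
    ultimately show "1 - y \<le> 2 * (real s - 3) * y" by (simp add: algebra_simps)
    show "base_count s (Suc s) \<le> M" unfolding M_def using assms(2) by (intro card_osc_base) simp
  qed (use assms in \<open>auto simp: y_def\<close>)
qed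

lemma growth_rate_4:
  assumes "7 / 2 < \<gamma>" "\<gamma> \<le> 5"
  shows "\<exists>C. permutation_class C \<and> has_growth_rate C \<gamma>"
proof (rule growth_rate_large[OF assms(1), of 5])
  define y where "y = 1 / \<gamma>"
  have y: "0 < y" "y < 2 / 7" using assms by (auto simp: y_def field_simps)
  have pw: "y ^ n \<le> (2 / 7) ^ n" for n using y by (intro power_mono) auto
  have "{1..5::nat} = {1, 2, 3, 4, 5}" by auto
  then have "(\<Sum>n=1..5. real (ind_count n) * y ^ n) = real (ind_count 1) * y ^ 1 + real (ind_count 2) * y\<^sup>2
      + real (ind_count 3) * y ^ 3 + real (ind_count 4) * y ^ 4 + real (ind_count 5) * y ^ 5"
    by simp
  also have "\<dots> \<le> 1 * (2/7) ^ 1 + 1 * (2/7)\<^sup>2 + 3 * (2/7) ^ 3 + 24 * (2/7) ^ 4 + 120 * (2/7) ^ 5"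
    using y ind_count_le_fact[of 1] ind_count_2 ind_count_3 ind_count_le_fact[of 4] ind_count_le_fact[of 5]
    by (intro add_mono mult_mono pw) (auto simp: fact_numeral)
  finally have 1: "(\<Sum>n=1..5. real (ind_count n) * y ^ n) \<le> 9 / 10" by (simp add: eval_nat_numeral)
  have "12 * y ^ 6 / (1 - y) \<le> 12 * (2/7) ^ 6 / (5/7)"
    using y by (intro frac_le mult_left_mono pw) auto
  then show "(\<Sum>n=1..5. real (ind_count n) * (1 / \<gamma>) ^ n) + real ((5 - 1) * (5 - 2)) * (1 / \<gamma>) ^ Suc 5 / (1 - 1 / \<gamma>) \<le> 1"
    using 1 unfolding y_def[symmetric] by (simp add: eval_nat_numeral)
qed (use assms in auto)

text \<open>Takes the least \<open>s\<close> allowed by \<open>growth_rate_large\<close>. The terms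
  \<open>fact n * y ^ n\<close> decrease while \<open>n \<le> \<gamma>\<close>, so each of the
  roughly \<open>\<gamma> / 2\<close> terms is at most \<open>2 * y\<^sup>2\<close>, and factorial
  bounds suffice.\<close>

lemma growth_rate_5:
  assumes "5 < \<gamma>"
  shows "\<exists>C. permutation_class C \<and> has_growth_rate C \<gamma>"
proof -
  define s where "s = nat \<lceil>(\<gamma> + 5) / 2\<rceil>"
  have s1: "\<gamma> + 5 \<le> 2 * real s"
    unfolding s_def using real_nat_ceiling_ge[of "(\<gamma> + 5) / 2"] by simp
  have s2: "2 * real s < \<gamma> + 7"
    unfolding s_def using ceiling_correct[of "(\<gamma> + 5) / 2"] assms by simp
  have "5 < real s" using s1 assms by linarith
  then have s: "\<gamma> + 5 \<le> 2 * real s" "2 * real s < \<gamma> + 7" "6 \<le> s" using s1 s2 by simp_all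
  define y where "y = 1 / \<gamma>"
  have y: "0 < y" "y < 1 / 5" "\<gamma> * y = 1" using assms by (auto simp: y_def field_simps)
  have small: "fact n * y ^ n \<le> 2 * y\<^sup>2" if "2 \<le> n" "real n \<le> \<gamma>" for n
    using that
  proof (induction n rule: dec_induct)
    case (step n)
    have "fact (Suc n) * y ^ Suc n = (real (Suc n) * y) * (fact n * y ^ n)" by (simp add: algebra_simps)
    also have "\<dots> \<le> 1 * (2 * y\<^sup>2)"
    proof (rule mult_mono)
      have "real (Suc n) * y \<le> \<gamma> * y" using step y by (intro mult_right_mono) auto
      then show "real (Suc n) * y \<le> 1" using y by simp
    qed (use step y in auto)
    finally show ?case by simp
  qed (simp add: power2_eq_square)
  have fac: "fact n * y ^ n \<le> 2 * y\<^sup>2" if "2 \<le> n" "n \<le> s" for n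
  proof (cases "real n \<le> \<gamma>")
    case False
    \<comment> \<open>\<open>\<gamma> < n \<le> s < (\<gamma> + 7) / 2\<close> forces
      \<open>\<gamma> < 7\<close>, so 6 is the only exception; there
      \<open>720 / 5 ^ 4 < 2\<close>.\<close>
    then have "n = 6" using assms that s by linarith
    moreover have "y ^ 4 \<le> (1 / 5) ^ 4" using y by (intro power_mono) auto
    then have "720 * y ^ 4 * y\<^sup>2 \<le> 2 * y\<^sup>2" by (intro mult_right_mono) (auto simp: eval_nat_numeral)
    ultimately show ?thesis by (simp add: fact_numeral flip: power_add)
  qed (use small that in blast)
  have "(\<Sum>n=1..s. real (ind_count n) * y ^ n) = real (ind_count 1) * y + (\<Sum>n=2..s. real (ind_count n) * y ^ n)"
    using s(3) by (subst sum.atLeast_Suc_atMost) (auto simp: numeral_2_eq_2)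
  also have "\<dots> \<le> 1 * y + (\<Sum>n=2..s. 2 * y\<^sup>2)"
  proof (intro add_mono sum_mono)
    fix n assume n: "n \<in> {2..s}"
    have "real (ind_count n) * y ^ n \<le> fact n * y ^ n"
    proof (rule mult_right_mono)
      show "real (ind_count n) \<le> fact n"
        using of_nat_mono[OF ind_count_le_fact[of n], where 'a = real] by simp
    qed (use y in simp)
    also have "\<dots> \<le> 2 * y\<^sup>2" using fac n by simp
    finally show "real (ind_count n) * y ^ n \<le> 2 * y\<^sup>2" .
  qed (use ind_count_le_fact[of 1] y in auto)
  also have "\<dots> = y + 2 * (real s - 1) * y\<^sup>2" using s(3) by (simp add: of_nat_diff)
  also have "\<dots> \<le> y + (\<gamma> + 5) * y\<^sup>2" using s(2) y by (intro add_left_mono mult_right_mono) auto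
  also have "\<dots> = 2 * y + 5 * y\<^sup>2" using y by (simp add: power2_eq_square algebra_simps)
  also have "\<dots> \<le> 2 * (1/5) + 5 * (1/5)\<^sup>2" using y by (intro add_mono mult_left_mono power_mono) auto
  finally have 1: "(\<Sum>n=1..s. real (ind_count n) * y ^ n) \<le> 3 / 5" by (simp add: power2_eq_square)
  \<comment> \<open>Lets the estimate \<open>fac\<close> at \<open>n = s\<close> also control the
    tail of the base.\<close>
  have "(s - 1) * (s - 2) \<le> fact s"
  proof -
    have "(s - 1) * (s - 2) \<le> (s - 1) * fact (s - 2)"
      by (intro mult_le_mono2 fact_ge_self)
    also have "\<dots> \<le> s * ((s - 1) * fact (s - 2))" using s(3) by simp
    also have "\<dots> = fact s"
      using s(3) fact_reduce[of s, where 'a = nat] fact_reduce[of "s - 1", where 'a = nat] by (simp add: numeral_2_eq_2)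
    finally show ?thesis .
  qed
  then have "real ((s - 1) * (s - 2)) \<le> fact s"
    using of_nat_mono[of "(s - 1) * (s - 2)" "fact s", where 'a = real] by (simp del: of_nat_mult)
  then have "real ((s - 1) * (s - 2)) * y ^ s \<le> fact s * y ^ s"
    using y by (intro mult_right_mono) auto
  also have "\<dots> \<le> 2 * y\<^sup>2" using fac s(3) by simp
  also have "\<dots> \<le> 2 * (1/5)\<^sup>2" using y by (intro mult_left_mono power_mono) auto
  finally have "real ((s - 1) * (s - 2)) * y ^ s \<le> 2 * (1/5)\<^sup>2" .
  then have "(real ((s - 1) * (s - 2)) * y ^ s) * (y / (1 - y)) \<le> 2 * (1/5)\<^sup>2 * 1"
    by (rule mult_mono) (use y in auto)
  then have 2: "real ((s - 1) * (s - 2)) * y ^ Suc s / (1 - y) \<le> 2 / 25"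
    by (simp add: power2_eq_square mult_ac)
  show ?thesis
  proof (rule growth_rate_large[of _ s])
    show "(\<Sum>n=1..s. real (ind_count n) * (1 / \<gamma>) ^ n)
        + real ((s - 1) * (s - 2)) * (1 / \<gamma>) ^ Suc s / (1 - 1 / \<gamma>) \<le> 1"
      using 1 2 unfolding y_def by linarith
  qed (use assms s in auto)
qed

theorem theorem1p1:
  shows "(\<exists>!x. quintic x = 0) \<and>
    (\<forall>\<gamma>::real. \<gamma> > lam \<longrightarrow> (\<exists>C. permutation_class C \<and> has_growth_rate C \<gamma>))"
proof (intro conjI allI impI quintic_ex1)
  fix \<gamma> :: real assume "lam < \<gamma>"
  consider "\<gamma> \<le> 3" | "3 < \<gamma>" "\<gamma> \<le> 7 / 2" | "7 / 2 < \<gamma>" "\<gamma> \<le> 5" | "5 < \<gamma>"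
    by linarith
  then show "\<exists>C. permutation_class C \<and> has_growth_rate C \<gamma>"
    using \<open>lam < \<gamma>\<close> growth_rate_near_lam growth_rate_3 growth_rate_4 growth_rate_5
    by cases simp_all
qed

end
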